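(* Let $I \subseteq A$ and $J \subseteq B$ be monomial ideals, regarded also as ideals of $S = A\otimes_{\mathbbm{k}} B$ via extension. Let $u$ be any positive rational number. Then $$(I+J)_u = \sum_{0 \le \omega \le u,\ \omega \in \mathbb{Q}} I_\omega \cdot J_{u-\omega},$$ where the rational powers $I_\omega$, $J_{u-\omega}$ are extended to $S$ (with $I_0 = A$, $J_0 = B$), and the sum on the right-hand side is a finite sum (i.e., only finitely many distinct ideals $I_\omega J_{u-\omega}$ occur).
   Context: $\mathbbm{k}$ is a field, $A = \mathbbm{k}[X_1,\dots,X_r]$, $B = \mathbbm{k}[Y_1,\dots,Y_s]$, $S = A\otimes_{\mathbbm{k}} B = \mathbbm{k}[X_1,\dots,X_r,Y_1,\dots,Y_s]$. For an ideal $I$ in a domain $R$ and a positive rational $u = p/q$ ($p,q\in\mathbb{N}$, $q\neq 0$), the $u$-th rational power is $I_u = \{x \in R : x^q \in \overline{I^p}\}$, where $\overline{\,\cdot\,}$ denotes integral closure; this does not depend on the representation of $u$. Integral closure of $I$ in $A$ extended to $S$ coincides with the integral closure of $IS$. *)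

theory Defs
  imports Complex_Main "HOL-Library.Poly_Mapping"
begin

text \<open>Ideal theory relative to a subring R (a carrier set inside a commutative ring type).\<close>

definition ideal_in :: "'r::comm_ring_1 set \<Rightarrow> 'r set \<Rightarrow> bool" where
  "ideal_in R I \<longleftrightarrow> I \<subseteq> R \<and> 0 \<in> I \<and> (\<forall>x\<in>I. \<forall>y\<in>I. x + y \<in> I)
     \<and> (\<forall>r\<in>R. \<forall>x\<in>I. r * x \<in> I)"

definition gen_ideal :: "'r::comm_ring_1 set \<Rightarrow> 'r set \<Rightarrow> 'r set" where
  "gen_ideal R X = \<Inter> {I. ideal_in R I \<and> X \<subseteq> I}"

definition ideal_mult :: "'r::comm_ring_1 set \<Rightarrow> 'r set \<Rightarrow> 'r set \<Rightarrow> 'r set" where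
  "ideal_mult R I J = gen_ideal R {a * b | a b. a \<in> I \<and> b \<in> J}"

definition ideal_add :: "'r::comm_ring_1 set \<Rightarrow> 'r set \<Rightarrow> 'r set \<Rightarrow> 'r set" where
  "ideal_add R I J = gen_ideal R (I \<union> J)"

fun ideal_pow :: "'r::comm_ring_1 set \<Rightarrow> 'r set \<Rightarrow> nat \<Rightarrow> 'r set" where
  "ideal_pow R I 0 = R"
| "ideal_pow R I (Suc n) = ideal_mult R (ideal_pow R I n) I"

definition int_closure :: "'r::comm_ring_1 set \<Rightarrow> 'r set \<Rightarrow> 'r set" where
  "int_closure R I = {x \<in> R. \<exists>n::nat. n \<ge> 1 \<and> (\<exists>a::nat \<Rightarrow> 'r.
      (\<forall>i\<in>{1..n}. a i \<in> ideal_pow R I i) \<and>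
      x ^ n + (\<Sum>i=1..n. a i * x ^ (n - i)) = 0)}"

definition rat_power :: "'r::comm_ring_1 set \<Rightarrow> 'r set \<Rightarrow> rat \<Rightarrow> 'r set" where
  "rat_power R I u = (case quotient_of u of (p, q) \<Rightarrow>
      {x \<in> R. x ^ nat q \<in> int_closure R (ideal_pow R I (nat p))})"

text \<open>Polynomial ring S = k[X_1..X_r, Y_1..Y_s]: variables indexed by 'a + 'b,
  the X's being Inl and the Y's being Inr.\<close>
type_synonym ('a, 'b, 'k) spoly = "('a + 'b \<Rightarrow>\<^sub>0 nat) \<Rightarrow>\<^sub>0 'k"

definition ringA :: "('a, 'b, 'k::field) spoly set" where
  "ringA = {p. \<forall>m\<in>Poly_Mapping.keys p. \<forall>v\<in>Poly_Mapping.keys m. isl v}"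

definition ringB :: "('a, 'b, 'k::field) spoly set" where
  "ringB = {p. \<forall>m\<in>Poly_Mapping.keys p. \<forall>v\<in>Poly_Mapping.keys m. \<not> isl v}"

definition monomials :: "(('v \<Rightarrow>\<^sub>0 nat) \<Rightarrow>\<^sub>0 'k::field) set" where
  "monomials = {Poly_Mapping.single m 1 | m. True}"

definition monomial_ideal :: "(('v \<Rightarrow>\<^sub>0 nat) \<Rightarrow>\<^sub>0 'k::field) set \<Rightarrow> (('v \<Rightarrow>\<^sub>0 nat) \<Rightarrow>\<^sub>0 'k) set \<Rightarrow> bool" where
  "monomial_ideal R I \<longleftrightarrow> ideal_in R I \<and>
     (\<exists>M. M \<subseteq> monomials \<inter> R \<and> I = gen_ideal R M)"

definition ext_ideal :: "'r::comm_ring_1 set \<Rightarrow> 'r set" where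
  "ext_ideal I = gen_ideal UNIV I"

end

theory Submission
  imports Defs "Jordan_Normal_Form.Char_Poly" "HOL-Library.Multiset"
begin

text \<open>
  For a monomial ideal \<open>I\<close> with exponent set \<open>E\<close>, a polynomial lies in \<open>I\<^sub>u\<close> iff all its exponents
  \<open>m\<close> lie in \<open>u\<close> times the Newton polyhedron of \<open>E\<close>, that is, iff \<open>N m\<close> dominates a sum of \<open>u N\<close>
  elements of \<open>E\<close> for some \<open>N \<ge> 1\<close>. Given this, the theorem is combinatorics: a sum of elements of
  \<open>E \<union> F\<close> splits into its \<open>E\<close>-part and its \<open>F\<close>-part, and the two parts live in disjoint sets of
  variables; the number of summands in each part gives \<open>\<omega>\<close> and \<open>u - \<omega>\<close>.

  Polynomials supported in the polyhedron are integral by the determinant trick, applied to the module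
  spanned by the long sums of exponents of \<open>f\<close>. Conversely, if \<open>f\<^sup>q\<close> is integral over \<open>I\<^sup>p\<close>, then
  \<open>f\<^sup>i\<close> lies in \<open>I\<^sup>k\<close> with \<open>k\<close> equal to \<open>p i / q\<close> up to a constant, and this remains true after
  discarding the part of \<open>f\<close> supported in the polyhedron. An exponent \<open>m\<close> of maximal Euclidean norm of
  what is left is a vertex, so \<open>i m\<close> is an exponent of its \<open>i\<close>-th power; Dickson's lemma turns the
  resulting asymptotic domination into an exact one, so \<open>m\<close> is in the polyhedron after all.
\<close>

section \<open>The determinant trick\<close>

text \<open>Cayley-Hamilton with weights. The family \<open>D\<close> stands for the powers of an
  ideal. The matrix \<open>g * 1 - a\<close> kills \<open>v\<close>, so after multiplication by the
  adjugate its determinant kills every \<open>v i\<close>; this determinant is the characteristic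
  polynomial of \<open>a\<close> evaluated at \<open>g\<close>, hence monic in
  \<open>g\<close>.\<close>

lemma determinant_trick:
  fixes D :: "nat \<Rightarrow> 'r::comm_ring_1 set"
  assumes zero: "\<And>k. 0 \<in> D k" and one: "1 \<in> D 0"
    and add: "\<And>k x y. x \<in> D k \<Longrightarrow> y \<in> D k \<Longrightarrow> x + y \<in> D k"
    and uminus: "\<And>k x. x \<in> D k \<Longrightarrow> - x \<in> D k"
    and mult: "\<And>j k x y. x \<in> D j \<Longrightarrow> y \<in> D k \<Longrightarrow> x * y \<in> D (j + k)"
    and a: "\<And>i j. i < d \<Longrightarrow> j < d \<Longrightarrow> a i j \<in> D 1"
    and eq: "\<And>i. i < d \<Longrightarrow> g * v i = (\<Sum>j<d. a i j * v j)"
  shows "\<exists>b. (\<forall>k\<in>{1..d}. b k \<in> D k) \<and>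
    (\<forall>i<d. (g ^ d + (\<Sum>k=1..d. b k * g ^ (d - k))) * v i = 0)"
proof -
  define A where "A = mat d d (\<lambda>(i,j). a i j)"
  have A: "A \<in> carrier_mat d d" by (simp add: A_def)
  \<comment> \<open>\<open>H k p\<close> says that \<open>p\<close> behaves like a form of weight
    \<open>k\<close>, where the indeterminate has weight 1 and \<open>D j\<close> has weight
    \<open>j\<close>. Entries of the characteristic matrix have weight 1, so the Leibniz expansion
    of its determinant has weight \<open>d\<close>.\<close>
  define H where "H k p \<longleftrightarrow> degree p \<le> k \<and> (\<forall>i\<le>k. coeff p i \<in> D (k - i))" for k and p :: "'r poly"
  have sum_D: "sum f S \<in> D k" if "\<And>x. x \<in> S \<Longrightarrow> f x \<in> D k" for f :: "'c \<Rightarrow> 'r" and S k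
    using that by (induction S rule: infinite_finite_induct) (auto intro: zero add)
  have H_sum: "H k (sum f S)" if "\<And>x. x \<in> S \<Longrightarrow> H k (f x)" for f :: "'c \<Rightarrow> 'r poly" and S k
    using that by (auto simp: H_def coeff_sum degree_sum_le intro!: sum_D)
       (metis (no_types, lifting) degree_sum_le degree_0 le0 sum.infinite)
  have H_mult: "H (j + k) (p * q)" if p: "H j p" and q: "H k q" for p q j k
  proof -
    have "degree (p * q) \<le> j + k"
      using p q degree_mult_le[of p q] by (auto simp: H_def)
    moreover have "coeff (p * q) i \<in> D (j + k - i)" if "i \<le> j + k" for i
      unfolding coeff_mult
    proof (rule sum_D)
      fix l assume l: "l \<in> {..i}"
      show "coeff p l * coeff q (i - l) \<in> D (j + k - i)"
      proof (cases "l \<le> j \<and> i - l \<le> k")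
        case True
        then have "j - l + (k - (i - l)) = j + k - i" using l by auto
        then show ?thesis using True p q mult[of "coeff p l" "j - l" "coeff q (i - l)" "k - (i - l)"]
          by (auto simp: H_def)
      next
        case False
        then have "coeff p l = 0 \<or> coeff q (i - l) = 0"
          using p q by (auto simp: H_def coeff_eq_0)
        then show ?thesis using zero by auto
      qed
    qed
    ultimately show ?thesis by (auto simp: H_def)
  qed
  have H_prod: "H (card S) (prod f S)" if "finite S" "\<And>x. x \<in> S \<Longrightarrow> H 1 (f x)"
    for f :: "nat \<Rightarrow> 'r poly" and S
    using that
  proof (induction S rule: finite_induct)
    case empty
    then show ?case by (simp add: H_def one)
  next
    case (insert x S)
    then show ?case using H_mult[of 1 "f x" "card S" "prod f S"] by simp
  qed
  have H_sign: "H 0 (signof p)" for p :: "nat \<Rightarrow> nat"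
    by (cases p rule: sign_cases) (auto simp: H_def one uminus)
  have H_entry: "H 1 (char_poly_matrix A $$ (i, j))" if "i < d" "j < d" for i j
    using that a[OF that]
    by (auto simp: H_def char_poly_matrix_def A_def coeff_pCons one zero uminus le_Suc_eq split: nat.splits)
  have H_char: "H d (char_poly A)"
    unfolding char_poly_def det_def'[OF char_poly_matrix_closed[OF A]]
  proof (rule H_sum)
    fix p assume "p \<in> {p. p permutes {0..<d}}"
    then have "p i < d" if "i < d" for i using that by (auto simp: permutes_in_image[of p "{0..<d}"]
          dest: permutes_in_image[of p "{0..<d}" i])
    then have "H (card {0..<d}) (\<Prod>i = 0..<d. char_poly_matrix A $$ (i, p i))"
      by (intro H_prod H_entry) auto
    with H_mult[OF H_sign[of p] this]
    show "H d (signof p * (\<Prod>i = 0..<d. char_poly_matrix A $$ (i, p i)))" by simp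
  qed
  \<comment> \<open>Coefficients are numbered from the top, so that \<open>b k\<close> has weight
    \<open>k\<close>; the leading one, \<open>b 0 = 1\<close>, splits off as
    \<open>g ^ d\<close>.\<close>
  define b where "b k = coeff (char_poly A) (d - k)" for k
  have "b k \<in> D k" if "k \<in> {1..d}" for k
    using H_char that by (auto simp: H_def b_def dest: spec[of _ "d - k"])
  moreover have "(g ^ d + (\<Sum>k=1..d. b k * g ^ (d - k))) * v i = 0" if i: "i < d" for i
  proof -
    define B where "B = mat d d (\<lambda>(i,j). (if i = j then g else 0) - a i j)"
    have B: "B \<in> carrier_mat d d" by (simp add: B_def)
    define w where "w = vec d v"
    have w: "w \<in> carrier_vec d" by (simp add: w_def)
    have "poly (char_poly A) g = det B"
      unfolding char_poly_def
      by (rule poly_det_cong[of _ d]) (use A B in \<open>auto simp: char_poly_matrix_def A_def B_def\<close>)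
    moreover have "poly (char_poly A) g = (\<Sum>i\<le>d. coeff (char_poly A) i * g ^ i)"
      using degree_monic_char_poly[OF A] by (simp add: poly_altdef)
    moreover have "\<dots> = (\<Sum>k\<le>d. b k * g ^ (d - k))"
      unfolding b_def by (rule sum.reindex_bij_witness[of _ "\<lambda>k. d - k" "\<lambda>k. d - k"]) auto
    moreover have "{..d} = insert 0 {1..d}" by auto
    ultimately have char: "g ^ d + (\<Sum>k=1..d. b k * g ^ (d - k)) = det B"
      using degree_monic_char_poly[OF A] by (simp add: b_def)
    have "B *\<^sub>v w = 0\<^sub>v d"
    proof (rule eq_vecI)
      fix k assume k: "k < dim_vec (0\<^sub>v d)"
      then have "(B *\<^sub>v w) $ k = (\<Sum>j<d. ((if k = j then g else 0) - a k j) * v j)"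
        by (simp add: B_def w_def scalar_prod_def atLeast0LessThan)
      also have "\<dots> = g * v k - (\<Sum>j<d. a k j * v j)"
        using k by (simp add: left_diff_distrib sum_subtractf if_distrib[of "\<lambda>x. x * _"] cong: if_cong)
      finally show "(B *\<^sub>v w) $ k = 0\<^sub>v d $ k" using k eq by simp
    qed (simp add: B_def)
    moreover have "adj_mat B *\<^sub>v 0\<^sub>v d = 0\<^sub>v d"
      using adj_mat(1)[OF B] by (intro eq_vecI) auto
    ultimately have "(adj_mat B * B) *\<^sub>v w = 0\<^sub>v d"
      using adj_mat(1)[OF B] B w by (simp add: assoc_mult_mat_vec[of _ d d _ d])
    then have "(det B \<cdot>\<^sub>m 1\<^sub>m d) *\<^sub>v w = 0\<^sub>v d" by (simp add: adj_mat(3)[OF B])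
    then have "((det B \<cdot>\<^sub>m 1\<^sub>m d) *\<^sub>v w) $ i = 0" using i by simp
    moreover have "((det B \<cdot>\<^sub>m 1\<^sub>m d) *\<^sub>v w) $ i = (\<Sum>j<d. (if i = j then det B else 0) * v j)"
      using i by (auto simp: w_def scalar_prod_def atLeast0LessThan intro!: sum.cong)
    ultimately have "det B * v i = 0"
      using i by (simp add: if_distrib[of "\<lambda>x. x * _"] cong: if_cong)
    then show ?thesis by (simp only: char)
  qed
  ultimately show ?thesis by blast
qed

section \<open>Exponent vectors\<close>

abbreviation lookup :: "('a \<Rightarrow>\<^sub>0 'b::zero) \<Rightarrow> 'a \<Rightarrow> 'b" where "lookup \<equiv> Poly_Mapping.lookup"
abbreviation keys :: "('a \<Rightarrow>\<^sub>0 'b::zero) \<Rightarrow> 'a set" where "keys \<equiv> Poly_Mapping.keys"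
abbreviation single :: "'a \<Rightarrow> 'b \<Rightarrow> 'a \<Rightarrow>\<^sub>0 'b::zero" where "single \<equiv> Poly_Mapping.single"

lemma lookup_iterate_add:
  fixes m :: "'v \<Rightarrow>\<^sub>0 nat"
  shows "lookup (iterate_add n m) v = n * lookup m v"
  by (induction n) (simp_all add: lookup_add)

lemma sum_mset_replicate_mset_iterate:
  "sum_mset (replicate_mset n m) = iterate_add n (m :: 'a::cancel_comm_monoid_add)"
  by (induction n) simp_all

lemma exponent_diff:
  fixes m e :: "'v \<Rightarrow>\<^sub>0 nat"
  assumes "\<And>v. lookup e v \<le> lookup m v"
  shows "m = e + (m - e)"
  using assms by (intro poly_mapping_eqI) (simp add: lookup_add lookup_minus)

section \<open>Dickson's lemma\<close>

text \<open>A monotone subsequence exists. If it is decreasing, it is constant from the place where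
  its minimum is attained, and a constant tail is weakly increasing.\<close>

lemma incseq_subsequence_nat:
  fixes s :: "nat \<Rightarrow> nat"
  shows "\<exists>r. strict_mono r \<and> incseq (s \<circ> r)"
proof -
  obtain f where f: "strict_mono f" "monoseq (\<lambda>n. s (f n))" using seq_monosub by blast
  show ?thesis
  proof (cases "incseq (\<lambda>n. s (f n))")
    case True
    then show ?thesis using f by (auto simp: comp_def)
  next
    case False
    then have dec: "decseq (\<lambda>n. s (f n))" using f monoseq_iff by blast
    define L where "L = (LEAST x. x \<in> range (\<lambda>n. s (f n)))"
    have "L \<in> range (\<lambda>n. s (f n))" unfolding L_def by (rule LeastI[of _ "s (f 0)"]) auto
    then obtain N where N: "s (f N) = L" by auto
    have "s (f n) = L" if "n \<ge> N" for n
    proof (rule antisym)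
      show "s (f n) \<le> L" using decseqD[OF dec that] N by simp
      show "L \<le> s (f n)" unfolding L_def by (rule Least_le) auto
    qed
    then have "incseq (s \<circ> (\<lambda>n. f (n + N)))" by (simp add: incseq_def)
    moreover have "strict_mono (\<lambda>n. f (n + N))" using f(1) by (simp add: strict_mono_def)
    ultimately show ?thesis by blast
  qed
qed

lemma incseq_subsequence_finite:
  fixes s :: "nat \<Rightarrow> 'i \<Rightarrow> nat"
  assumes "finite W"
  shows "\<exists>r. strict_mono r \<and> (\<forall>i\<in>W. incseq (\<lambda>n. s (r n) i))"
  using assms
proof (induction W rule: finite_induct)
  case empty
  then show ?case by (auto intro: exI[of _ id] simp: strict_mono_def)
next
  case (insert x W)
  then obtain r where r: "strict_mono r" "\<forall>i\<in>W. incseq (\<lambda>n. s (r n) i)" by blast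
  obtain t where t: "strict_mono t" "incseq ((\<lambda>n. s (r n) x) \<circ> t)"
    using incseq_subsequence_nat by blast
  have "incseq (\<lambda>n. s (r (t n)) i)" if "i \<in> W" for i
    using r(2) that t(1) by (auto simp: incseq_def strict_mono_less_eq)
  then have "\<forall>i\<in>insert x W. incseq (\<lambda>n. s ((r \<circ> t) n) i)" using t(2) by (auto simp: comp_def)
  moreover have "strict_mono (r \<circ> t)" using r(1) t(1) by (simp add: strict_mono_def)
  ultimately show ?case by blast
qed

text \<open>This form of Dickson's lemma serves twice: over the variables for finite generation, and
  over generators together with variables in the asymptotic argument.\<close>

lemma dickson_pair:
  fixes s :: "nat \<Rightarrow> 'i \<Rightarrow> nat"
  assumes "finite W"
  shows "\<exists>n n'. n < n' \<and> (\<forall>i\<in>W. s n i \<le> s n' i)"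
proof -
  obtain r where r: "strict_mono r" "\<forall>i\<in>W. incseq (\<lambda>n. s (r n) i)"
    using incseq_subsequence_finite[OF assms] by blast
  have "r 0 < r 1" using r(1) by (simp add: strict_mono_def)
  moreover have "s (r 0) i \<le> s (r 1) i" if "i \<in> W" for i
    using r(2) that by (auto simp: incseq_def)
  ultimately show ?thesis by blast
qed

text \<open>The basis consists of the elements of \<open>E\<close> minimal for divisibility: they
  form an antichain, so a comparable pair excludes infinitely many, and descent on the total degree
  finds one below any element.\<close>

lemma dickson_finite_basis:
  fixes E :: "('v::finite \<Rightarrow>\<^sub>0 nat) set"
  shows "\<exists>F. finite F \<and> F \<subseteq> E \<and> (\<forall>e\<in>E. \<exists>f\<in>F. \<exists>d. e = f + d)"
proof -
  define le where "le a b \<longleftrightarrow> (\<forall>v. lookup a v \<le> lookup b v)"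
    for a b :: "'v \<Rightarrow>\<^sub>0 nat"
  define F where "F = {e\<in>E. \<forall>f\<in>E. le f e \<longrightarrow> f = e}"
  have "finite F"
  proof (rule ccontr)
    assume "infinite F"
    then obtain s :: "nat \<Rightarrow> _" where s: "inj s" "range s \<subseteq> F"
      using infinite_countable_subset by blast
    obtain n n' where n: "n < n'" "le (s n) (s n')"
      using dickson_pair[of UNIV "\<lambda>n. lookup (s n)"] by (auto simp: le_def)
    moreover have "s n \<in> E" "s n' \<in> F" using s(2) by (auto simp: F_def)
    ultimately have "s n = s n'" by (auto simp: F_def)
    then show False using s(1) n(1) by (auto dest: injD)
  qed
  moreover have "\<exists>f\<in>F. \<exists>d. e = f + d" if "e \<in> E" for e
    using that
  proof (induction "\<Sum>v\<in>UNIV. lookup e v" arbitrary: e rule: less_induct)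
    case less
    show ?case
    proof (cases "e \<in> F")
      case True
      then show ?thesis by (metis add.right_neutral)
    next
      case False
      then obtain f where f: "f \<in> E" "le f e" "f \<noteq> e" using less.prems by (auto simp: F_def)
      then obtain v where "lookup f v \<noteq> lookup e v"
        by (meson poly_mapping_eqI)
      then have "lookup f v < lookup e v"
        using f(2) by (auto simp: le_def intro: le_neq_trans)
      then have "(\<Sum>v\<in>UNIV. lookup f v) < (\<Sum>v\<in>UNIV. lookup e v)"
        using f(2) by (intro sum_strict_mono_ex1) (auto simp: le_def)
      then obtain g d where "g \<in> F" "f = g + d" using less.hyps f(1) by blast
      moreover have "e = f + (e - f)" using f(2) by (intro exponent_diff) (auto simp: le_def)
      ultimately show ?thesis by (metis add.assoc)
    qed
  qed
  ultimately show ?thesis by (intro exI[of _ F]) (auto simp: F_def)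
qed

section \<open>Exponents of powers of a monomial ideal\<close>

text \<open>The exponents of monomials in the \<open>k\<close>-th power of the ideal generated by
  the monomials with exponents in \<open>E\<close>: \<open>A\<close> lists \<open>k\<close>
  generators with repetition and \<open>d\<close> is an arbitrary cofactor. For \<open>k = 0\<close>
  this is the unit ideal.\<close>

definition mpow :: "'a::comm_monoid_add set \<Rightarrow> nat \<Rightarrow> 'a set" where
  "mpow E k = {sum_mset A + d | A d. set_mset A \<subseteq> E \<and> size A = k}"

lemma mpowI: "set_mset A \<subseteq> E \<Longrightarrow> size A = k \<Longrightarrow> sum_mset A + d \<in> mpow E k"
  by (auto simp: mpow_def)

lemma mpow_0 [simp]: "mpow E 0 = UNIV"
  by (auto simp: mpow_def)

lemma mpow_1: "mpow E (Suc 0) = {e + d | e d. e \<in> E}"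
proof (intro equalityI subsetI)
  fix m assume "m \<in> mpow E (Suc 0)"
  then obtain A d where A: "m = sum_mset A + d" "set_mset A \<subseteq> E" "size A = 1"
    by (auto simp: mpow_def)
  then obtain e where "A = {#e#}" using size_1_singleton_mset by blast
  with A show "m \<in> {e + d | e d. e \<in> E}" by auto
next
  fix m assume "m \<in> {e + d | e d. e \<in> E}"
  then obtain e d where "m = e + d" "e \<in> E" by auto
  then show "m \<in> mpow E (Suc 0)" using mpowI[of "{#e#}" E "Suc 0" d] by simp
qed

lemma mpow_up: "m \<in> mpow E k \<Longrightarrow> m + d \<in> mpow E k"
  by (auto simp: mpow_def add.assoc) (metis add.assoc)

lemma mpow_mono: "E \<subseteq> F \<Longrightarrow> mpow E k \<subseteq> mpow F k"
  by (fastforce simp: mpow_def)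

lemma mpow_add:
  assumes "a \<in> mpow E j" "b \<in> mpow E k"
  shows "a + b \<in> mpow E (j + k)"
proof -
  obtain A d B d' where *: "a = sum_mset A + d" "b = sum_mset B + d'" "set_mset A \<subseteq> E"
    "set_mset B \<subseteq> E" "size A = j" "size B = k"
    using assms by (auto simp: mpow_def)
  then have "a + b = sum_mset (A + B) + (d + d')" by (simp add: ac_simps)
  with * show ?thesis by (auto simp del: sum_mset.union intro!: mpowI)
qed

lemma mpow_split:
  assumes "m \<in> mpow E (j + k)"
  obtains a b where "a \<in> mpow E j" "b \<in> mpow E k" "m = a + b"
proof -
  obtain A d where A: "m = sum_mset A + d" "set_mset A \<subseteq> E" "size A = j + k"
    using assms by (auto simp: mpow_def)
  obtain xs where xs: "A = mset xs" by (metis ex_mset)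
  have "sum_mset (mset (take j xs)) + 0 \<in> mpow E j"
    using A xs by (intro mpowI) (auto dest: in_set_takeD)
  moreover have "sum_mset (mset (drop j xs)) + d \<in> mpow E k"
    using A xs by (intro mpowI) (auto dest: in_set_dropD)
  moreover have "A = mset (take j xs) + mset (drop j xs)"
    by (metis append_take_drop_id mset_append xs)
  ultimately show ?thesis using A(1) that by (metis add.assoc add.right_neutral sum_mset.union)
qed

lemma mpow_antimono: "j \<le> k \<Longrightarrow> mpow E k \<subseteq> mpow E j"
  by (metis le_add_diff_inverse mpow_split mpow_up subsetI)

lemma mpow_iterate:
  fixes m :: "'a::cancel_comm_monoid_add"
  assumes "m \<in> mpow E k"
  shows "iterate_add n m \<in> mpow E (n * k)"
proof (induction n)
  case (Suc n)
  then show ?case using mpow_add[OF assms Suc] by simp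
qed simp

text \<open>The generators are sorted into members of \<open>E\<close> and the rest, which lie in
  \<open>F\<close>; a common generator counts for \<open>E\<close>, and the cofactor goes with the
  \<open>E\<close>-part.\<close>

lemma mpow_Un_split:
  assumes "m \<in> mpow (E \<union> F) k"
  obtains i j a b where "i + j = k" "a \<in> mpow E i" "b \<in> mpow F j" "m = a + b"
proof -
  obtain A d where A: "m = sum_mset A + d" "set_mset A \<subseteq> E \<union> F" "size A = k"
    using assms by (auto simp: mpow_def)
  define A1 where "A1 = filter_mset (\<lambda>x. x \<in> E) A"
  define A2 where "A2 = filter_mset (\<lambda>x. x \<notin> E) A"
  have AA: "A = A1 + A2" unfolding A1_def A2_def by (rule multiset_partition)
  have "sum_mset A1 + d \<in> mpow E (size A1)" by (intro mpowI) (auto simp: A1_def)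
  moreover have "sum_mset A2 + 0 \<in> mpow F (size A2)"
    using A(2) by (intro mpowI) (auto simp: A2_def)
  moreover have "size A1 + size A2 = k" using A AA by simp
  moreover have "m = (sum_mset A1 + d) + (sum_mset A2 + 0)" using A AA by (simp add: ac_simps)
  ultimately show ?thesis using that by blast
qed

lemma mpow_1_cong:
  assumes "F \<subseteq> E" "\<And>e. e \<in> E \<Longrightarrow> \<exists>f\<in>F. \<exists>d. e = f + d"
  shows "mpow E (Suc 0) = mpow F (Suc 0)"
  using assms unfolding mpow_1 by (fastforce simp: add.assoc)

text \<open>The difference of two comparable (Dickson) members of the family of witnesses
  turns an asymptotic membership into an exact one.\<close>
lemma mpow_asymptotic:
  fixes E :: "('v::finite \<Rightarrow>\<^sub>0 nat) set"
  assumes fin: "finite E" and *: "\<And>n. iterate_add (q * n + c) m \<in> mpow E (p * n)"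
  shows "\<exists>N\<ge>1. iterate_add (q * N) m \<in> mpow E (p * N)"
proof -
  have "\<forall>n. \<exists>A d. iterate_add (q * n + c) m = sum_mset A + d \<and> set_mset A \<subseteq> E \<and> size A = p * n"
    using * by (fastforce simp: mpow_def)
  then obtain A d where A: "\<And>n. iterate_add (q * n + c) m = sum_mset (A n) + d n"
    "\<And>n. set_mset (A n) \<subseteq> E" "\<And>n. size (A n) = p * n" by metis
  \<comment> \<open>Generator multiplicities and cofactor form one vector of naturals, so for a
    comparable pair both the multiset and the cofactor can be subtracted.\<close>
  define s where "s n = case_sum (count (A n)) (lookup (d n))" for n
  obtain n n' where n: "n < n'" and le: "\<And>i. i \<in> E <+> UNIV \<Longrightarrow> s n i \<le> s n' i"
    using dickson_pair[of "E <+> UNIV" s] fin by auto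
  have "count (A n) e \<le> count (A n') e" for e
  proof (cases "e \<in> E")
    case True
    then show ?thesis using le[OF InlI] by (simp add: s_def)
  next
    case False
    then show ?thesis using A(2)[of n] by (metis count_eq_zero_iff le0 subsetD)
  qed
  then have sub: "A n \<subseteq># A n'" by (simp add: subseteq_mset_def)
  then obtain B where B: "A n' = A n + B" by (auto simp: subset_mset.le_iff_add)
  have dle: "d n' = d n + (d n' - d n)"
    using le[OF InrI[OF UNIV_I]] by (intro exponent_diff) (auto simp: s_def)
  have sz: "size B = p * (n' - n)" using A(3)[of n] A(3)[of n'] B by (simp add: diff_mult_distrib2)
  \<comment> \<open>Subtracting the identity at \<open>n\<close> from the one at \<open>n'\<close>
    cancels the offset \<open>c\<close> and leaves the exact ratio of \<open>p\<close> to
    \<open>q\<close>.\<close>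
  have "iterate_add (q * (n' - n)) m + iterate_add (q * n + c) m = iterate_add (q * n' + c) m"
    using n by (intro poly_mapping_eqI)
      (auto simp: lookup_add lookup_iterate_add algebra_simps dest!: less_imp_add_positive)
  also have "\<dots> = sum_mset (A n) + sum_mset B + (d n + (d n' - d n))"
    using A(1)[of n'] B dle by simp
  also have "\<dots> = (sum_mset B + (d n' - d n)) + iterate_add (q * n + c) m"
    using A(1)[of n] by (simp add: ac_simps)
  finally have "iterate_add (q * (n' - n)) m = sum_mset B + (d n' - d n)" by simp
  moreover have "set_mset B \<subseteq> E" using A(2)[of n'] B by auto
  ultimately have "iterate_add (q * (n' - n)) m \<in> mpow E (p * (n' - n))"
    using sz mpowI[of B E _ "d n' - d n"] by simp
  then show ?thesis using n by (intro exI[of _ "n' - n"]) auto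
qed

section \<open>Polynomials with prescribed exponents\<close>

definition kspan :: "'m set \<Rightarrow> ('m \<Rightarrow>\<^sub>0 'k::zero) set" where
  "kspan X = {f. keys f \<subseteq> X}"

definition exps :: "'v set \<Rightarrow> ('v \<Rightarrow>\<^sub>0 nat) set" where
  "exps V = {m. keys m \<subseteq> V}"

abbreviation polys :: "'v set \<Rightarrow> (('v \<Rightarrow>\<^sub>0 nat) \<Rightarrow>\<^sub>0 'k::zero) set" where
  "polys V \<equiv> kspan (exps V)"

text \<open>Describes by exponents the \<open>k\<close>-th power of the monomial ideal generated by
  \<open>E\<close> in the variables \<open>V\<close>; \<open>gen_ideal_monomials\<close> and
  \<open>ideal_pow_mideal\<close> justify this.\<close>

definition mideal :: "'v set \<Rightarrow> ('v \<Rightarrow>\<^sub>0 nat) set \<Rightarrow> nat \<Rightarrow> (('v \<Rightarrow>\<^sub>0 nat) \<Rightarrow>\<^sub>0 'k::zero) set" where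
  "mideal V E k = kspan (exps V \<inter> mpow E k)"

lemma keys_add_nat: "keys (a + b) = keys a \<union> keys (b :: 'v \<Rightarrow>\<^sub>0 nat)"
  by (auto simp: in_keys_iff lookup_add)

lemma exps_add_iff [simp]: "a + b \<in> exps V \<longleftrightarrow> a \<in> exps V \<and> b \<in> exps V"
  by (auto simp: exps_def keys_add_nat)

lemma zero_in_exps [simp]: "0 \<in> exps V"
  by (simp add: exps_def)

lemma exps_UNIV [simp]: "exps UNIV = UNIV"
  by (simp add: exps_def)

lemma kspan_UNIV [simp]: "kspan UNIV = UNIV"
  by (simp add: kspan_def)

lemma kspan_0 [simp]: "0 \<in> kspan X"
  by (simp add: kspan_def)

lemma kspan_add: "f \<in> kspan X \<Longrightarrow> g \<in> kspan X \<Longrightarrow> f + g \<in> kspan X"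
  using Poly_Mapping.keys_add[of f g] by (auto simp: kspan_def)

lemma kspan_uminus: "f \<in> kspan X \<Longrightarrow> - f \<in> kspan X" for f :: "'m \<Rightarrow>\<^sub>0 'k::ab_group_add"
  by (auto simp: kspan_def in_keys_iff subset_iff)

lemma kspan_sum: "(\<And>x. x \<in> S \<Longrightarrow> f x \<in> kspan X) \<Longrightarrow> sum f S \<in> kspan X"
  by (induction S rule: infinite_finite_induct) (auto intro: kspan_add)

lemma kspan_mult:
  assumes "f \<in> kspan X" "g \<in> kspan Y" "\<And>x y. x \<in> X \<Longrightarrow> y \<in> Y \<Longrightarrow> x + y \<in> Z"
  shows "f * g \<in> kspan Z"
  using assms keys_mult[of f g] unfolding kspan_def by blast

lemma kspan_single: "m \<in> X \<Longrightarrow> single m c \<in> kspan X"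
  by (simp add: kspan_def)

lemma single_one_in_kspan_iff [simp]:
  "single m (1::'k::zero_neq_one) \<in> kspan X \<longleftrightarrow> m \<in> X"
  by (simp add: kspan_def)

lemma kspan_mono: "X \<subseteq> Y \<Longrightarrow> kspan X \<subseteq> kspan Y"
  by (auto simp: kspan_def)

lemma poly_mapping_sum_singles: "f = (\<Sum>m\<in>keys f. single m (lookup f m))"
  by (rule poly_mapping_eqI)
     (simp add: lookup_sum lookup_single when_def in_keys_iff)

lemma mideal_0: "mideal V E 0 = polys V"
  by (simp add: mideal_def)

lemma mideal_add: "f \<in> mideal V E k \<Longrightarrow> g \<in> mideal V E k \<Longrightarrow> f + g \<in> mideal V E k"
  unfolding mideal_def by (rule kspan_add)

lemma mideal_mult:
  "f \<in> mideal V E j \<Longrightarrow> g \<in> mideal V E k \<Longrightarrow> f * g \<in> mideal V E (j + k)"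
  unfolding mideal_def by (erule kspan_mult, assumption) (auto intro: mpow_add)

lemma mideal_antimono: "j \<le> k \<Longrightarrow> mideal V E k \<subseteq> mideal V E j"
  unfolding mideal_def using mpow_antimono by (intro kspan_mono) blast

lemma one_in_polys: "1 \<in> polys V"
  by (simp add: kspan_def)

lemma polys_mult: "f \<in> polys V \<Longrightarrow> g \<in> polys V \<Longrightarrow> f * g \<in> polys V"
  by (erule kspan_mult) auto

lemma polys_power: "f \<in> polys V \<Longrightarrow> f ^ n \<in> polys V"
  by (induction n) (auto intro: polys_mult one_in_polys)

section \<open>Ideals spanned by monomials\<close>

lemma ideal_in_kspan:
  assumes "\<And>x d. x \<in> X \<Longrightarrow> x + d \<in> X"
  shows "ideal_in (polys V) (kspan (exps V \<inter> X) :: (('v \<Rightarrow>\<^sub>0 nat) \<Rightarrow>\<^sub>0 'k::comm_ring_1) set)"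
proof -
  have "kspan (exps V \<inter> X) \<subseteq> polys V" by (rule kspan_mono) auto
  moreover have "r * x \<in> kspan (exps V \<inter> X)" if "r \<in> polys V" "x \<in> kspan (exps V \<inter> X)"
    for r x :: "('v \<Rightarrow>\<^sub>0 nat) \<Rightarrow>\<^sub>0 'k"
    unfolding mult.commute[of r] using that(2,1) by (rule kspan_mult) (use assms in auto)
  ultimately show ?thesis by (simp add: ideal_in_def kspan_add)
qed

lemma ideal_in_mideal: "ideal_in (polys V) (mideal V E k)"
  unfolding mideal_def by (rule ideal_in_kspan) (rule mpow_up)

lemma ideal_in_sum: "ideal_in R K \<Longrightarrow> (\<And>x. x \<in> S \<Longrightarrow> f x \<in> K) \<Longrightarrow> sum f S \<in> K"
  by (induction S rule: infinite_finite_induct) (auto simp: ideal_in_def)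

lemma gen_ideal_least: "ideal_in R K \<Longrightarrow> X \<subseteq> K \<Longrightarrow> gen_ideal R X \<subseteq> K"
  by (auto simp: gen_ideal_def)

lemma gen_ideal_superset: "X \<subseteq> gen_ideal R X"
  by (auto simp: gen_ideal_def)

text \<open>The ideal \<open>K\<close> makes the family intersected in \<open>gen_ideal\<close>
  nonempty, so that the intersection stays inside \<open>R\<close>.\<close>

lemma ideal_in_gen_ideal:
  assumes "ideal_in R K" "X \<subseteq> K"
  shows "ideal_in R (gen_ideal R X)"
proof -
  have "gen_ideal R X \<subseteq> R" using gen_ideal_least[OF assms] assms(1) by (auto simp: ideal_in_def)
  then show ?thesis by (auto simp: gen_ideal_def ideal_in_def)
qed

lemma kspan_subset_ideal:
  fixes K :: "(('v \<Rightarrow>\<^sub>0 nat) \<Rightarrow>\<^sub>0 'k::comm_ring_1) set"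
  assumes "ideal_in (polys V) K" "\<And>m. m \<in> X \<Longrightarrow> single m 1 \<in> K"
  shows "kspan X \<subseteq> K"
proof
  fix f :: "('v \<Rightarrow>\<^sub>0 nat) \<Rightarrow>\<^sub>0 'k" assume f: "f \<in> kspan X"
  have "single m (lookup f m) \<in> K" if "m \<in> keys f" for m
  proof -
    have "single 0 (lookup f m) * single m 1 \<in> K"
      using assms that f by (auto simp: ideal_in_def kspan_def)
    then show ?thesis by (simp add: mult_single)
  qed
  then have "(\<Sum>m\<in>keys f. single m (lookup f m)) \<in> K" by (rule ideal_in_sum[OF assms(1)])
  then show "f \<in> K" by (simp flip: poly_mapping_sum_singles)
qed

lemma gen_ideal_monomials:
  assumes "E \<subseteq> exps V"
  shows "gen_ideal (polys V) ((\<lambda>e. single e 1) ` E) =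
    (mideal V E 1 :: (('v \<Rightarrow>\<^sub>0 nat) \<Rightarrow>\<^sub>0 'k::comm_ring_1) set)" (is "?G = _")
proof
  have sub: "(\<lambda>e. single e 1) ` E \<subseteq> (mideal V E 1 :: (('v \<Rightarrow>\<^sub>0 nat) \<Rightarrow>\<^sub>0 'k) set)"
    using assms by (force simp: mideal_def mpow_1 intro: exI[of _ 0])
  show "?G \<subseteq> mideal V E 1" by (rule gen_ideal_least[OF ideal_in_mideal sub])
  have G: "ideal_in (polys V) ?G" using sub by (rule ideal_in_gen_ideal[OF ideal_in_mideal])
  show "mideal V E 1 \<subseteq> ?G" unfolding mideal_def
  proof (rule kspan_subset_ideal[OF G])
    fix m assume "m \<in> exps V \<inter> mpow E 1"
    then obtain e d where ed: "m = e + d" "e \<in> E" "d \<in> exps V" by (auto simp: mpow_1)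
    have "single e 1 \<in> ?G" using ed(2) by (intro subsetD[OF gen_ideal_superset] imageI)
    moreover have "single d (1::'k) \<in> polys V" using ed(3) by simp
    ultimately have "single d 1 * single e 1 \<in> ?G" using G unfolding ideal_in_def by blast
    then show "single m 1 \<in> ?G" using ed by (simp add: mult_single add.commute)
  qed
qed

lemma ideal_mult_mideal:
  "ideal_mult (polys V) (mideal V E j) (mideal V E k) =
    (mideal V E (j + k) :: (('v \<Rightarrow>\<^sub>0 nat) \<Rightarrow>\<^sub>0 'k::comm_ring_1) set)" (is "?G = _")
proof
  let ?P = "{a * b | a b. a \<in> mideal V E j \<and> b \<in> mideal V E k} :: (('v \<Rightarrow>\<^sub>0 nat) \<Rightarrow>\<^sub>0 'k) set"
  have sub: "?P \<subseteq> mideal V E (j + k)" by (auto intro: mideal_mult)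
  then show "?G \<subseteq> mideal V E (j + k)"
    unfolding ideal_mult_def by (rule gen_ideal_least[OF ideal_in_mideal])
  have G: "ideal_in (polys V) ?G" unfolding ideal_mult_def
    using sub by (rule ideal_in_gen_ideal[OF ideal_in_mideal])
  show "mideal V E (j + k) \<subseteq> ?G" unfolding mideal_def[of _ _ "j + k"]
  proof (rule kspan_subset_ideal[OF G])
    fix m assume m: "m \<in> exps V \<inter> mpow E (j + k)"
    then obtain a b where ab: "a \<in> mpow E j" "b \<in> mpow E k" "m = a + b" using mpow_split by blast
    with m have "single a 1 * single b 1 \<in> ?P" by (force simp: mideal_def)
    then have "single a 1 * single b 1 \<in> ?G"
      unfolding ideal_mult_def by (rule subsetD[OF gen_ideal_superset])
    then show "single m 1 \<in> ?G" using ab by (simp add: mult_single)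
  qed
qed

lemma ideal_pow_mideal:
  "ideal_pow (polys V) (mideal V E p) n =
    (mideal V E (p * n) :: (('v \<Rightarrow>\<^sub>0 nat) \<Rightarrow>\<^sub>0 'k::comm_ring_1) set)"
  by (induction n) (simp_all add: mideal_0 ideal_mult_mideal add.commute)

text \<open>Dickson's lemma thins the given generators to finitely many, as required by the
  asymptotic argument and by the count of rational powers.\<close>

lemma monomial_ideal_finite_exponents:
  fixes I :: "(('v::finite \<Rightarrow>\<^sub>0 nat) \<Rightarrow>\<^sub>0 'k::field) set"
  assumes "monomial_ideal (polys V) I"
  obtains E where "finite E" "E \<subseteq> exps V" "I = mideal V E 1"
proof -
  obtain M where M: "M \<subseteq> monomials \<inter> polys V" "I = gen_ideal (polys V) M"
    using assms by (auto simp: monomial_ideal_def)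
  define F where "F = {m. single m 1 \<in> M}"
  have MF: "M = (\<lambda>e. single e 1) ` F" using M(1) by (auto simp: F_def monomials_def)
  have F: "F \<subseteq> exps V"
  proof
    fix m assume "m \<in> F"
    then have "single m (1::'k) \<in> polys V" using M(1) by (auto simp: F_def)
    then show "m \<in> exps V" by simp
  qed
  obtain E where E: "finite E" "E \<subseteq> F" "\<forall>e\<in>F. \<exists>f\<in>E. \<exists>d. e = f + d"
    using dickson_finite_basis[of F] by auto
  then have "mpow F (Suc 0) = mpow E (Suc 0)" by (intro mpow_1_cong) auto
  then have "I = mideal V E 1" using M(2) gen_ideal_monomials[OF F] MF by (simp add: mideal_def)
  then show ?thesis using that E F by blast
qed

section \<open>Coefficients of a product that arise from a single pair of terms\<close>

lemma lookup_mult_unique: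
  fixes f g :: "'m::cancel_comm_monoid_add \<Rightarrow>\<^sub>0 'k::comm_ring_1"
  assumes "\<And>a b. a \<in> keys f \<Longrightarrow> b \<in> keys g \<Longrightarrow> a + b = x + y \<Longrightarrow> a = x \<and> b = y"
  shows "lookup (f * g) (x + y) = lookup f x * lookup g y"
proof -
  define f' where "f' = f - single x (lookup f x)"
  define g' where "g' = g - single y (lookup g y)"
  have f': "keys f' \<subseteq> keys f - {x}" and g': "keys g' \<subseteq> keys g - {y}"
    by (auto simp: f'_def g'_def in_keys_iff lookup_minus lookup_single when_def split: if_splits)
  \<comment> \<open>With the terms at \<open>x\<close> and \<open>y\<close> split off, the
    hypothesis keeps \<open>f' * g\<close>, and cancellation keeps the other mixed product, from
    contributing at \<open>x + y\<close>.\<close>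
  have "f * g = single x (lookup f x) * single y (lookup g y) + single x (lookup f x) * g' + f' * g"
    by (simp add: f'_def g'_def algebra_simps)
  moreover have "x + y \<notin> keys (f' * g)"
  proof
    assume "x + y \<in> keys (f' * g)"
    then obtain a b where "a \<in> keys f'" "b \<in> keys g" "x + y = a + b" using keys_mult[of f' g] by auto
    then show False using assms[of a b] f' by auto
  qed
  moreover have "x + y \<notin> keys (single x (lookup f x) * g')"
  proof
    assume "x + y \<in> keys (single x (lookup f x) * g')"
    then obtain b where "b \<in> keys g'" "x + y = x + b"
      using keys_mult[of "single x (lookup f x)" g'] by (auto split: if_splits)
    then show False using g' by auto
  qed
  ultimately show ?thesis by (simp add: lookup_add mult_single in_keys_iff)
qed

text \<open>Monomials are non-zero-divisors over any coefficient ring, which allows cancelling the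
  one left by the determinant trick.\<close>

lemma single_mult_eq_0D:
  fixes P :: "'m::cancel_comm_monoid_add \<Rightarrow>\<^sub>0 'k::comm_ring_1"
  assumes "P * single s 1 = 0"
  shows "P = 0"
proof (rule poly_mapping_eqI)
  fix m
  have "lookup (P * single s 1) (m + s) = lookup P m * lookup (single s 1) s"
    by (rule lookup_mult_unique) (auto split: if_splits)
  then show "lookup P m = lookup 0 m" by (simp add: assms)
qed

section \<open>Rational powers of monomial ideals\<close>

text \<open>The lattice points of the Newton polyhedron of \<^term>\<open>E\<close> scaled by \<^term>\<open>u\<close>,
  described by integer multiples only.\<close>
definition newton :: "('v \<Rightarrow>\<^sub>0 nat) set \<Rightarrow> rat \<Rightarrow> ('v \<Rightarrow>\<^sub>0 nat) set" where
  "newton E u = {m. \<exists>N K. N \<ge> 1 \<and> of_nat K = u * of_nat N \<and> iterate_add N m \<in> mpow E K}"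

lemma iterate_add_mult: "iterate_add (j * k) (m :: 'v \<Rightarrow>\<^sub>0 nat) = iterate_add j (iterate_add k m)"
  by (rule poly_mapping_eqI) (simp add: lookup_iterate_add)

lemma iterate_add_plus:
  "iterate_add n (a + b) = iterate_add n a + iterate_add n (b :: 'v \<Rightarrow>\<^sub>0 nat)"
  by (rule poly_mapping_eqI) (simp add: lookup_iterate_add lookup_add algebra_simps)

text \<open>\<open>newton\<close> admits any denominator \<open>N\<close> of \<open>u\<close>.
  Multiplying a witness by \<open>q\<close> adapts it to the given, possibly unreduced, fraction,
  because \<open>q * K = p * N\<close>.\<close>

lemma newton_fraction_iff:
  assumes "u = of_nat p / of_nat q" "q > 0"
  shows "m \<in> newton E u \<longleftrightarrow> (\<exists>N\<ge>1. iterate_add (q * N) m \<in> mpow E (p * N))"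
proof
  assume "m \<in> newton E u"
  then obtain N K where N: "N \<ge> 1" "of_nat K = u * of_nat N" "iterate_add N m \<in> mpow E K"
    by (auto simp: newton_def)
  have "of_nat (q * K) = (of_nat (p * N) :: rat)" using N(2) assms by (simp add: field_simps)
  then have "q * K = p * N" using of_nat_eq_iff by blast
  then have "iterate_add (q * N) m \<in> mpow E (p * N)"
    using mpow_iterate[OF N(3), of q] by (simp add: iterate_add_mult)
  then show "\<exists>N\<ge>1. iterate_add (q * N) m \<in> mpow E (p * N)" using N(1) by blast
next
  assume "\<exists>N\<ge>1. iterate_add (q * N) m \<in> mpow E (p * N)"
  then obtain N where "N \<ge> 1" "iterate_add (q * N) m \<in> mpow E (p * N)" by blast
  moreover have "of_nat (p * N) = u * of_nat (q * N)" using assms by (simp add: field_simps)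
  ultimately show "m \<in> newton E u"
    using assms(2) unfolding newton_def by (intro CollectI exI[of _ "q * N"] exI[of _ "p * N"]) simp
qed

lemma newton_common_denominator:
  assumes "u = of_nat p / of_nat q" "q > 0" "finite T" "T \<subseteq> newton E u"
  shows "\<exists>N\<ge>1. \<forall>t\<in>T. iterate_add (q * N) t \<in> mpow E (p * N)"
  using assms(3,4)
proof (induction T rule: finite_induct)
  case (insert t T)
  then obtain N where N: "N \<ge> 1" "\<forall>t\<in>T. iterate_add (q * N) t \<in> mpow E (p * N)" by auto
  obtain M where M: "M \<ge> 1" "iterate_add (q * M) t \<in> mpow E (p * M)"
    using insert.prems newton_fraction_iff[OF assms(1,2), of t E] by auto
  have "iterate_add (q * (M * N)) x \<in> mpow E (p * (M * N))" if "x \<in> insert t T" for x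
  proof (cases "x = t")
    case True
    have "q * (M * N) = N * (q * M)" "p * (M * N) = N * (p * M)" by auto
    then show ?thesis using mpow_iterate[OF M(2), of N] True by (simp only: iterate_add_mult)
  next
    case False
    then have "iterate_add (q * N) x \<in> mpow E (p * N)" using that N by auto
    moreover have "q * (M * N) = M * (q * N)" "p * (M * N) = M * (p * N)" by auto
    ultimately show ?thesis using mpow_iterate[of "iterate_add (q * N) x" E "p * N" M]
      by (simp only: iterate_add_mult)
  qed
  moreover have "M * N \<ge> 1" using M N by (metis mult_le_mono nat_mult_1)
  ultimately show ?case by blast
qed (auto intro: exI[of _ 1])

lemma newton_up: "m \<in> newton E u \<Longrightarrow> m + d \<in> newton E u"
  unfolding newton_def by (force simp: iterate_add_plus intro: mpow_up)

lemma newton_add: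
  assumes "a \<in> newton E u" "b \<in> newton F w"
  shows "a + b \<in> newton (E \<union> F) (u + w)"
proof -
  obtain N K where N: "N \<ge> 1" "of_nat K = u * of_nat N" "iterate_add N a \<in> mpow E K"
    using assms by (auto simp: newton_def)
  obtain M L where M: "M \<ge> 1" "of_nat L = w * of_nat M" "iterate_add M b \<in> mpow F L"
    using assms by (auto simp: newton_def)
  have "iterate_add (M * N) a \<in> mpow (E \<union> F) (M * K)"
    using mpow_iterate[OF N(3), of M] mpow_mono[of E "E \<union> F"] by (auto simp: iterate_add_mult)
  moreover have "iterate_add (N * M) b \<in> mpow (E \<union> F) (N * L)"
    using mpow_iterate[OF M(3), of N] mpow_mono[of F "E \<union> F"] by (auto simp: iterate_add_mult)
  ultimately have "iterate_add (M * N) (a + b) \<in> mpow (E \<union> F) (M * K + N * L)"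
    by (simp add: iterate_add_plus mult.commute[of N M] mpow_add)
  moreover have "of_nat (M * K + N * L) = (u + w) * of_nat (M * N)"
    using N(2) M(2) by (simp add: algebra_simps)
  moreover have "M * N \<ge> 1" using M N by (metis mult_le_mono nat_mult_1)
  ultimately show ?thesis unfolding newton_def by blast
qed

section \<open>Polynomials supported in the Newton polyhedron are integral\<close>

lemma keys_power_multisets:
  "keys (f ^ k) \<subseteq> {sum_mset A | A. set_mset A \<subseteq> keys f \<and> size A = k}"
proof (induction k)
  case 0
  then show ?case by auto
next
  case (Suc k)
  show ?case
  proof
    fix m assume "m \<in> keys (f ^ Suc k)"
    then obtain a b where ab: "a \<in> keys f" "b \<in> keys (f ^ k)" "m = a + b"
      using keys_mult[of f "f ^ k"] by auto
    then obtain A where "b = sum_mset A" "set_mset A \<subseteq> keys f" "size A = k" using Suc by blast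
    then show "m \<in> {sum_mset A | A. set_mset A \<subseteq> keys f \<and> size A = Suc k}"
      using ab by (intro CollectI exI[of _ "add_mset a A"]) auto
  qed
qed

lemma multiset_pigeonhole:
  assumes "finite T" "set_mset A \<subseteq> T" "size A > card T * (Q - 1)"
  shows "\<exists>t\<in>T. replicate_mset Q t \<subseteq># A"
proof (rule ccontr)
  assume "\<not> ?thesis"
  then have *: "count A t \<le> Q - 1" if "t \<in> T" for t
    using that by (force simp: count_le_replicate_mset_subset_eq[symmetric])
  have "size A = (\<Sum>t\<in>set_mset A. count A t)" by (simp add: size_multiset_overloaded_eq)
  also have "\<dots> \<le> (\<Sum>t\<in>T. count A t)" using assms by (intro sum_mono2) auto
  also have "\<dots> \<le> (\<Sum>t\<in>T. Q - 1)" by (intro sum_mono *)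
  finally show False using assms(3) by simp
qed

text \<open>Let \<open>I\<close> be the ideal generated by \<open>E\<close>. Multiplication by
  \<open>h\<close> maps the module spanned by the monomials with exponents in \<open>W\<close> into
  its multiple by the \<open>k\<close>-th power of \<open>I\<close>; the determinant trick gives an
  expression that kills a monomial, hence vanishes.\<close>

lemma integral_of_stable_exponents:
  fixes h :: "('v \<Rightarrow>\<^sub>0 nat) \<Rightarrow>\<^sub>0 'k::comm_ring_1"
  assumes W: "finite W" "W \<noteq> {}" "W \<subseteq> exps V" and h: "h \<in> polys V"
    and stable: "\<And>s r. s \<in> W \<Longrightarrow> r \<in> keys h \<Longrightarrow> \<exists>w\<in>W. \<exists>e\<in>mpow E k. s + r = w + e"
  shows "\<exists>d\<ge>1. \<exists>b. (\<forall>i\<in>{1..d}. b i \<in> mideal V E (k * i)) \<and>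
    h ^ d + (\<Sum>i=1..d. b i * h ^ (d - i)) = 0"
proof -
  obtain w e where we: "\<And>s r. s \<in> W \<Longrightarrow> r \<in> keys h \<Longrightarrow> w s r \<in> W"
    "\<And>s r. s \<in> W \<Longrightarrow> r \<in> keys h \<Longrightarrow> e s r \<in> mpow E k"
    "\<And>s r. s \<in> W \<Longrightarrow> r \<in> keys h \<Longrightarrow> s + r = w s r + e s r"
    using stable by metis
  have eV: "e s r \<in> exps V" if "s \<in> W" "r \<in> keys h" for s r
  proof -
    have "s + r \<in> exps V" using that W h by (auto simp: kspan_def)
    then show ?thesis using we(3)[OF that] by simp
  qed
  define d where "d = card W"
  have d: "d \<ge> 1" using W by (simp add: d_def Suc_le_eq card_gt_0_iff)
  obtain x where x: "bij_betw x {..<d} W"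
    using ex_bij_betw_nat_finite[OF W(1)] by (auto simp: d_def atLeast0LessThan)
  have xW: "x i \<in> W" if "i < d" for i using x that by (auto simp: bij_betw_def)
  define v where "v i = single (x i) (1::'k)" for i
  \<comment> \<open>The terms of \<open>h\<close> are grouped by the monomial \<open>v j\<close>
    that they reach from \<open>v i\<close>; the leftover exponent \<open>e\<close> carries the
    \<open>k\<close> generators.\<close>
  define a where "a i j = (\<Sum>r\<in>{r \<in> keys h. w (x i) r = x j}. single (e (x i) r) (lookup h r))" for i j
  have a: "a i j \<in> mideal V E (k * 1)" if "i < d" "j < d" for i j
    unfolding a_def mideal_def
    using we(2) eV xW[OF that(1)] by (intro kspan_sum kspan_single) auto
  have eq: "h * v i = (\<Sum>j<d. a i j * v j)" if i: "i < d" for i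
  proof -
    have "h * v i = (\<Sum>r\<in>keys h. single r (lookup h r)) * v i" by (simp flip: poly_mapping_sum_singles)
    also have "\<dots> = (\<Sum>r\<in>keys h. single (x i + r) (lookup h r))"
      by (simp add: v_def sum_distrib_right mult_single add.commute)
    also have "\<dots> = (\<Sum>y\<in>W. \<Sum>r\<in>{r \<in> keys h. w (x i) r = y}. single (x i + r) (lookup h r))"
      using we(1)[OF xW[OF i]] W by (intro sum.group[symmetric]) auto
    also have "\<dots> = (\<Sum>j<d. \<Sum>r\<in>{r \<in> keys h. w (x i) r = x j}. single (x i + r) (lookup h r))"
      by (rule sum.reindex_bij_betw[OF x, symmetric])
    also have "\<dots> = (\<Sum>j<d. a i j * v j)"
      unfolding a_def v_def sum_distrib_right
      using we(3)[OF xW[OF i]] by (intro sum.cong refl) (auto simp: mult_single add.commute)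
    finally show ?thesis .
  qed
  have "\<exists>b. (\<forall>i\<in>{1..d}. b i \<in> mideal V E (k * i)) \<and>
    (\<forall>i<d. (h ^ d + (\<Sum>i=1..d. b i * h ^ (d - i))) * v i = 0)"
  \<comment> \<open>The family is \<open>D i = mideal V E (k * i)\<close>, so entries in the
    \<open>k\<close>-th power have weight 1.\<close>
  proof (rule determinant_trick[where a = a])
    show "- f \<in> mideal V E (k * i)" if "f \<in> mideal V E (k * i)" for i and f :: "('v \<Rightarrow>\<^sub>0 nat) \<Rightarrow>\<^sub>0 'k"
      using that unfolding mideal_def by (rule kspan_uminus)
    show "f * g \<in> mideal V E (k * (i + j))" if "f \<in> mideal V E (k * i)" "g \<in> mideal V E (k * j)"
      for i j and f g :: "('v \<Rightarrow>\<^sub>0 nat) \<Rightarrow>\<^sub>0 'k"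
      using mideal_mult[OF that] by (simp add: distrib_left)
  qed (use a eq one_in_polys in \<open>auto simp: mideal_0 mideal_add\<close>, simp add: mideal_def)
  then obtain b where "\<forall>i\<in>{1..d}. b i \<in> mideal V E (k * i)"
    "(h ^ d + (\<Sum>i=1..d. b i * h ^ (d - i))) * single (x 0) 1 = 0"
    using d by (auto simp: v_def)
  then show ?thesis using d single_mult_eq_0D by blast
qed

lemma integral_of_newton:
  fixes f :: "('v \<Rightarrow>\<^sub>0 nat) \<Rightarrow>\<^sub>0 'k::comm_ring_1"
  assumes u: "u = of_nat p / of_nat q" "q > 0" and f: "f \<in> polys V" "keys f \<subseteq> newton E u"
  shows "f ^ q \<in> int_closure (polys V) (mideal V E p)"
proof -
  define T where "T = keys f"
  have T: "finite T" "T \<subseteq> exps V" using f by (auto simp: T_def kspan_def)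
  obtain N where N: "N \<ge> 1" "\<And>t. t \<in> T \<Longrightarrow> iterate_add (q * N) t \<in> mpow E (p * N)"
    using newton_common_denominator[OF u T(1), of E] f by (auto simp: T_def)
  define Q where "Q = q * N"
  have Q: "Q \<ge> 1" using N u by (simp add: Q_def Suc_le_eq)
  \<comment> \<open>\<open>W k\<close> contains the sums of \<open>k\<close> exponents of
    \<open>f\<close>. For \<open>n = card T * Q\<close>, a sum of \<open>n + Q\<close> exponents
    repeats some \<open>t\<close> at least \<open>Q\<close> times by the pigeonhole principle; these
    copies supply \<open>p * N\<close> generators, and \<open>n\<close> exponents remain.\<close>
  define W where "W k = {sum_mset A | A. set_mset A \<subseteq> T \<and> size A = k}" for k
  define n where "n = card T * Q"
  have W_exps: "W k \<subseteq> exps V" for k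
  proof -
    have "sum_mset A \<in> exps V" if "set_mset A \<subseteq> T" for A
      using that T(2) by (induction A) auto
    then show ?thesis by (auto simp: W_def)
  qed
  have "W n = sum_mset ` multisets_of_size T n" by (auto simp: W_def multisets_of_size_def)
  then have "finite (W n)" using T(1) by auto
  moreover have "W n \<noteq> {}"
  \<comment> \<open>For \<open>f = 0\<close> there are no exponents, but then \<open>n = 0\<close>
    and the empty sum lies in \<open>W 0\<close>.\<close>
  proof (cases "T = {}")
    case True
    then show ?thesis by (auto simp: W_def n_def)
  next
    case False
    then obtain t where "t \<in> T" by auto
    then have "sum_mset (replicate_mset n t) \<in> W n"
      unfolding W_def by (intro CollectI exI[of _ "replicate_mset n t"]) auto
    then show ?thesis by blast
  qed
  moreover have "\<exists>w\<in>W n. \<exists>e\<in>mpow E (p * N). s + r = w + e"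
    if s: "s \<in> W n" and r: "r \<in> keys (f ^ Q)" for s r
  proof -
    obtain A where A: "s = sum_mset A" "set_mset A \<subseteq> T" "size A = n" using s unfolding W_def by blast
    obtain B where B: "r = sum_mset B" "set_mset B \<subseteq> T" "size B = Q"
      using r keys_power_multisets[of f Q] unfolding T_def by blast
    have "card T * (Q - 1) \<le> n" by (simp add: n_def)
    then obtain t where t: "t \<in> T" "replicate_mset Q t \<subseteq># A + B"
      using multiset_pigeonhole[OF T(1), of "A + B" Q] A B Q by auto
    then obtain C where C: "A + B = replicate_mset Q t + C" by (auto simp: subset_mset.le_iff_add)
    have "set_mset C \<subseteq> T" using A(2) B(2) arg_cong[OF C, of set_mset] by auto
    moreover have "size C = n" using A(3) B(3) arg_cong[OF C, of size] by simp
    ultimately have "sum_mset C \<in> W n" by (auto simp: W_def)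
    moreover have "s + r = sum_mset C + iterate_add Q t"
      using arg_cong[OF C, of sum_mset] A B by (simp add: sum_mset_replicate_mset_iterate add.commute)
    moreover have "iterate_add Q t \<in> mpow E (p * N)" using N(2)[OF t(1)] by (simp add: Q_def)
    ultimately show ?thesis by blast
  qed
  ultimately have "\<exists>d\<ge>1. \<exists>b. (\<forall>i\<in>{1..d}. b i \<in> mideal V E (p * N * i)) \<and>
    (f ^ Q) ^ d + (\<Sum>i=1..d. b i * (f ^ Q) ^ (d - i)) = 0"
    by (intro integral_of_stable_exponents[of "W n"] W_exps polys_power[OF f(1)])
  then obtain d b where d: "d \<ge> 1" and b: "\<And>i. i \<in> {1..d} \<Longrightarrow> b i \<in> mideal V E (p * N * i)"
    and eq: "(f ^ Q) ^ d + (\<Sum>i=1..d. b i * (f ^ Q) ^ (d - i)) = 0"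
    by blast
  \<comment> \<open>The equation of degree \<open>d\<close> for \<open>f ^ Q = (f ^ q) ^ N\<close>
    is read as one of degree \<open>N * d\<close> for \<open>f ^ q\<close>: position
    \<open>N * j\<close> carries \<open>b j\<close>, which lies in the power
    \<open>p * N * j\<close> as required, and the other positions carry 0.\<close>
  define c where "c i = (if N dvd i then b (i div N) else 0)" for i
  have "(\<Sum>i=1..d. b i * (f ^ Q) ^ (d - i)) = (\<Sum>i\<in>(\<lambda>i. N * i) ` {1..d}. c i * (f ^ q) ^ (N * d - i))"
    using N(1) by (subst sum.reindex)
      (auto simp: inj_on_def c_def Q_def power_mult right_diff_distrib' mult.assoc simp flip: power_mult)
  also have "\<dots> = (\<Sum>i=1..N * d. c i * (f ^ q) ^ (N * d - i))"
  proof (rule sum.mono_neutral_left)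
    show "\<forall>i\<in>{1..N * d} - (\<lambda>i. N * i) ` {1..d}. c i * (f ^ q) ^ (N * d - i) = 0"
      using N(1) by (auto simp: c_def elim!: dvdE)
  qed (use N(1) in auto)
  finally have "(f ^ q) ^ (N * d) + (\<Sum>i=1..N * d. c i * (f ^ q) ^ (N * d - i)) = 0"
    using eq by (simp add: Q_def power_mult)
  moreover have "c i \<in> mideal V E (p * i)" if "i \<in> {1..N * d}" for i
  proof (cases "N dvd i")
    case True
    then obtain j where "i = N * j" by (elim dvdE)
    then show ?thesis using that b[of j] N(1) by (auto simp: c_def mult.assoc)
  next
    case False
    then show ?thesis by (simp add: c_def mideal_def)
  qed
  moreover have "N * d \<ge> 1" using d N by (metis mult_le_mono nat_mult_1)
  ultimately show ?thesis
    unfolding int_closure_def ideal_pow_mideal using polys_power[OF f(1)] by blast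
qed

section \<open>Integral polynomials are supported in the Newton polyhedron\<close>

text \<open>A weakening of integral dependence of \<open>f\<^sup>q\<close> on the \<open>p\<close>-th power of the ideal that is
  evidently stable under sums, by the binomial theorem.\<close>
definition almost_in :: "('v \<Rightarrow>\<^sub>0 nat) set \<Rightarrow> nat \<Rightarrow> nat \<Rightarrow> (('v \<Rightarrow>\<^sub>0 nat) \<Rightarrow>\<^sub>0 'k::comm_ring_1) \<Rightarrow> bool" where
  "almost_in E p q f \<longleftrightarrow> (\<exists>c. \<forall>i. f ^ i \<in> kspan (mpow E (p * ((i - c) div q))))"

lemma kspan_mpow_mult_left:
  fixes f r :: "('v \<Rightarrow>\<^sub>0 nat) \<Rightarrow>\<^sub>0 'k::comm_ring_1"
  shows "f \<in> kspan (mpow E k) \<Longrightarrow> r * f \<in> kspan (mpow E k)"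
  unfolding mult.commute[of r]
  by (erule kspan_mult[where Y = UNIV]) (auto simp: kspan_def intro: mpow_up)

lemma almost_in_add:
  assumes "almost_in E p q f" "almost_in E p q g" "q > 0"
  shows "almost_in E p q (f + g)"
proof -
  obtain c where c: "\<And>i. f ^ i \<in> kspan (mpow E (p * ((i - c) div q)))"
    using assms by (auto simp: almost_in_def)
  obtain c' where c': "\<And>i. g ^ i \<in> kspan (mpow E (p * ((i - c') div q)))"
    using assms by (auto simp: almost_in_def)
  \<comment> \<open>The extra \<open>q\<close> in the new constant pays for rounding down twice,
    since two remainders add up to at most \<open>2 * q - 2\<close>.\<close>
  have "(f + g) ^ i \<in> kspan (mpow E (p * ((i - (c + c' + q)) div q)))" for i
    unfolding binomial_ring
  proof (rule kspan_sum)
    fix k assume k: "k \<in> {..i}"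
    have "(i - (c + c' + q)) div q \<le> (k - c) div q + (i - k - c') div q"
    proof -
      have "(x + y - q) div q \<le> x div q + y div q" for x y
      proof -
        have "x mod q + y mod q \<le> q + q - 2"
          using mod_less_divisor[OF assms(3), of x] mod_less_divisor[OF assms(3), of y] by linarith
        then have "x + y - q < q * (x div q + y div q + 1)"
          using mult_div_mod_eq[of q x] mult_div_mod_eq[of q y] assms(3)
          by (simp only: distrib_left mult_1_right)
        then show ?thesis using assms(3) by (simp add: div_less_iff_less_mult mult.commute less_Suc_eq_le[symmetric])
      qed
      then have "((k - c) + (i - k - c') - q) div q \<le> (k - c) div q + (i - k - c') div q" .
      moreover have "i - (c + c' + q) \<le> (k - c) + (i - k - c') - q" using k by auto
      ultimately show ?thesis by (meson div_le_mono order_trans)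
    qed
    then have "p * ((i - (c + c' + q)) div q) \<le> p * ((k - c) div q) + p * ((i - k - c') div q)"
      by (simp flip: distrib_left)
    moreover have "f ^ k * g ^ (i - k) \<in> kspan (mpow E (p * ((k - c) div q) + p * ((i - k - c') div q)))"
      using c[of k] c'[of "i - k"] by (rule kspan_mult) (rule mpow_add)
    ultimately have "f ^ k * g ^ (i - k) \<in> kspan (mpow E (p * ((i - (c + c' + q)) div q)))"
      using kspan_mono[OF mpow_antimono] by blast
    then show "of_nat (i choose k) * f ^ k * g ^ (i - k) \<in> kspan (mpow E (p * ((i - (c + c' + q)) div q)))"
      unfolding mult.assoc by (rule kspan_mpow_mult_left)
  qed
  then show ?thesis unfolding almost_in_def by blast
qed

lemma almost_in_uminus:
  assumes "almost_in E p q f"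
  shows "almost_in E p q (- f)"
proof -
  obtain c where c: "\<And>i. f ^ i \<in> kspan (mpow E (p * ((i - c) div q)))"
    using assms by (auto simp: almost_in_def)
  then have "(- f) ^ i \<in> kspan (mpow E (p * ((i - c) div q)))" for i
    unfolding power_minus[of f] by (intro kspan_mpow_mult_left)
  then show ?thesis unfolding almost_in_def by blast
qed

lemma almost_in_0:
  assumes "q > 0" shows "almost_in E p q 0"
proof -
  have "0 ^ i \<in> kspan (mpow E (p * ((i - 1) div q)))" for i
    by (cases i) (auto simp: kspan_def)
  then show ?thesis unfolding almost_in_def by blast
qed

lemma single_power: "single t c ^ i = single (iterate_add i t) (c ^ i)"
  for t :: "'v \<Rightarrow>\<^sub>0 nat" and c :: "'k::comm_ring_1"
  by (induction i) (simp_all add: mult_single)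

text \<open>Each block of \<open>Q = q * N\<close> factors supplies \<open>p * N\<close> generators;
  the incomplete last block is absorbed by the constant \<open>Q\<close>.\<close>

lemma almost_in_single:
  assumes u: "u = of_nat p / of_nat q" "q > 0" and t: "t \<in> newton E u"
  shows "almost_in E p q (single t c)"
proof -
  obtain N where N: "N \<ge> 1" "iterate_add (q * N) t \<in> mpow E (p * N)"
    using newton_fraction_iff[OF u, of t E] t by blast
  define Q where "Q = q * N"
  have Q: "Q > 0" using N u by (simp add: Q_def)
  have "single t c ^ i \<in> kspan (mpow E (p * ((i - Q) div q)))" for i
  proof -
    have "i - Q \<le> (i div Q) * Q"
      using div_mult_mod_eq[of i Q] mod_less_divisor[OF Q, of i] by linarith
    then have "(i - Q) div q \<le> ((i div Q) * Q) div q" by (rule div_le_mono)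
    also have "\<dots> = (i div Q) * N" using u(2) by (simp add: Q_def mult.left_commute)
    finally have le: "p * ((i - Q) div q) \<le> (i div Q) * (p * N)" by (simp add: mult.left_commute)
    have "iterate_add (i div Q * Q) t + iterate_add (i mod Q) t \<in> mpow E ((i div Q) * (p * N))"
      using mpow_iterate[OF N(2), of "i div Q"] by (intro mpow_up) (simp add: iterate_add_mult Q_def)
    then have "iterate_add i t \<in> mpow E ((i div Q) * (p * N))"
      by (simp flip: iterate_add_distrib)
    then show ?thesis using mpow_antimono[OF le, of E] by (auto simp: single_power intro!: kspan_single)
  qed
  then show ?thesis unfolding almost_in_def by blast
qed

lemma almost_in_newton:
  assumes u: "u = of_nat p / of_nat q" "q > 0" and f: "keys f \<subseteq> newton E u"
  shows "almost_in E p q f"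
proof -
  have "almost_in E p q (\<Sum>m\<in>S. single m (lookup f m))" if "S \<subseteq> keys f" for S
    using finite_subset[OF that finite_keys] that
  proof (induction S rule: finite_induct)
    case (insert m S)
    then have "m \<in> newton E u" using f by auto
    then show ?case using insert by (simp add: almost_in_add almost_in_single[OF u] u(2))
  qed (simp add: almost_in_0 u(2))
  from this[OF subset_refl] show ?thesis by (simp flip: poly_mapping_sum_singles)
qed

text \<open>The equation of degree \<open>M\<close> expresses \<open>g ^ (M + n)\<close> through
  lower powers of \<open>g\<close>, which by induction puts it into the \<open>p * n\<close>-th
  power of the ideal. Hence the constant \<open>q * M\<close> for \<open>f\<close>.\<close>

lemma almost_in_integral:
  fixes f :: "('v \<Rightarrow>\<^sub>0 nat) \<Rightarrow>\<^sub>0 'k::comm_ring_1"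
  assumes f: "f \<in> polys V" "f ^ q \<in> int_closure (polys V) (mideal V E p)" and q: "q > 0"
  shows "almost_in E p q f"
proof -
  define g where "g = f ^ q"
  obtain M a where a: "\<And>i. i \<in> {1..M} \<Longrightarrow> a i \<in> mideal V E (p * i)"
    and eq: "g ^ M + (\<Sum>i=1..M. a i * g ^ (M - i)) = 0"
    using f(2) unfolding int_closure_def ideal_pow_mideal g_def by blast
  have gV: "g \<in> polys V" using f(1) by (simp add: g_def polys_power)
  have pow: "g ^ (M + n) \<in> mideal V E (p * n)" for n
  proof (induction n rule: less_induct)
    case (less n)
    have "g ^ (M + n) = - ((\<Sum>i=1..M. a i * g ^ (M - i)) * g ^ n)"
      using eq by (simp add: power_add eq_neg_iff_add_eq_0 flip: distrib_right)
    also have "\<dots> = - (\<Sum>i=1..M. a i * g ^ (M - i + n))"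
      by (simp only: sum_distrib_right power_add mult.assoc)
    also have "\<dots> \<in> mideal V E (p * n)"
      unfolding mideal_def
    proof (intro kspan_uminus kspan_sum, fold mideal_def)
      fix i assume i: "i \<in> {1..M}"
      show "a i * g ^ (M - i + n) \<in> mideal V E (p * n)"
      proof (cases "i \<le> n")
        case True
        then have "M - i + n = M + (n - i)" using i by auto
        then have "g ^ (M - i + n) \<in> mideal V E (p * (n - i))" using less[of "n - i"] i True by auto
        moreover have "p * i + p * (n - i) = p * n" using True by (simp flip: distrib_left)
        ultimately show ?thesis using mideal_mult[OF a[OF i], of "g ^ (M - i + n)"] by metis
      next
        case False
        have "a i * g ^ (M - i + n) \<in> mideal V E (p * i + 0)"
          using polys_power[OF gV] by (intro mideal_mult a i) (simp add: mideal_0)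
        moreover have "p * n \<le> p * i + 0" using False by simp
        ultimately show ?thesis using mideal_antimono by blast
      qed
    qed
    finally show ?case .
  qed
  have "f ^ i \<in> kspan (mpow E (p * ((i - q * M) div q)))" for i
  proof (cases "i < q * M")
    case True
    then show ?thesis by (simp add: kspan_def)
  next
    case False
    define k where "k = (i - q * M) div q"
    have "q * k \<le> i - q * M" by (simp add: k_def)
    then have "i = (i - q * (M + k)) + q * (M + k)" using False by (simp add: distrib_left)
    then have "f ^ i = f ^ (i - q * (M + k)) * g ^ (M + k)"
      unfolding g_def by (metis power_add power_mult)
    moreover have "g ^ (M + k) \<in> kspan (mpow E (p * k))"
      using pow[of k] kspan_mono[of "exps V \<inter> mpow E (p * k)" "mpow E (p * k)"]
      by (auto simp: mideal_def)
    ultimately show ?thesis using kspan_mpow_mult_left unfolding k_def by metis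
  qed
  then show ?thesis unfolding almost_in_def by blast
qed

text \<open>An exponent of maximal Euclidean norm is a vertex of the Newton polytope, exposed by the
  linear functional given by the inner product with itself.\<close>
lemma vertex_power:
  fixes f :: "('v::finite \<Rightarrow>\<^sub>0 nat) \<Rightarrow>\<^sub>0 'k::field"
  assumes "f \<noteq> 0"
  obtains m where "m \<in> keys f" "\<And>k. iterate_add k m \<in> keys (f ^ k)"
proof -
  define nsq where "nsq m = (\<Sum>v\<in>UNIV. (lookup m v)\<^sup>2)" for m :: "'v \<Rightarrow>\<^sub>0 nat"
  have "keys f \<noteq> {}" using assms by simp
  then have "Max (nsq ` keys f) \<in> nsq ` keys f" by (intro Max_in) auto
  then obtain m where m: "m \<in> keys f" "Max (nsq ` keys f) = nsq m" by auto
  have nsq_le: "nsq x \<le> nsq m" if "x \<in> keys f" for x using that m(2) Max_ge[of "nsq ` keys f"] by fastforce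
  define \<phi> where "\<phi> x = (\<Sum>v\<in>UNIV. lookup m v * lookup x v)" for x :: "'v \<Rightarrow>\<^sub>0 nat"
  have \<phi>_add: "\<phi> (x + y) = \<phi> x + \<phi> y" for x y
    by (simp add: \<phi>_def lookup_add distrib_left sum.distrib)
  have \<phi>_m: "\<phi> m = nsq m" by (simp add: \<phi>_def nsq_def power2_eq_square)
  have \<phi>_less: "\<phi> x < \<phi> m" if x: "x \<in> keys f" "x \<noteq> m" for x
  proof -
    obtain v where "lookup x v \<noteq> lookup m v" using x(2) by (meson poly_mapping_eqI)
    \<comment> \<open>Expanding the squared distance of \<open>m\<close> and \<open>x\<close> and
      using that \<open>m\<close> has maximal norm gives \<open>\<phi> x < \<phi> m\<close>.\<close>
    then have "0 < (\<Sum>v\<in>UNIV. (int (lookup m v) - int (lookup x v))\<^sup>2)"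
      by (intro sum_pos2[of _ v]) auto
    also have "\<dots> = int (nsq m) + int (nsq x) - 2 * int (\<phi> x)"
      by (simp add: nsq_def \<phi>_def power2_diff sum.distrib sum_subtractf sum_distrib_left mult.assoc)
    finally show ?thesis using nsq_le[OF x(1)] by (simp add: \<phi>_m)
  qed
  \<comment> \<open>The induction also carries that on \<open>f ^ k\<close> the functional attains
    \<open>k * \<phi> m\<close> at most at \<open>iterate_add k m\<close>; so a single pair of terms
    contributes to the next coefficient, which is nonzero over a field.\<close>
  have "lookup (f ^ k) (iterate_add k m) \<noteq> 0 \<and>
    (\<forall>x\<in>keys (f ^ k). \<phi> x \<le> k * \<phi> m \<and> (\<phi> x = k * \<phi> m \<longrightarrow> x = iterate_add k m))" for k
  proof (induction k)
    case 0
    then show ?case by (simp add: \<phi>_def)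
  next
    case (Suc k)
    have key: "\<phi> (a + b) \<le> Suc k * \<phi> m \<and> (\<phi> (a + b) = Suc k * \<phi> m \<longrightarrow> a = m \<and> b = iterate_add k m)"
      if "a \<in> keys f" "b \<in> keys (f ^ k)" for a b
    proof -
      have "\<phi> b \<le> k * \<phi> m" "\<phi> b = k * \<phi> m \<longrightarrow> b = iterate_add k m" using Suc that by auto
      then show ?thesis using \<phi>_less[OF that(1)] by (cases "a = m") (auto simp: \<phi>_add)
    qed
    have \<phi>_it: "\<phi> (iterate_add k m) = k * \<phi> m" for k by (induction k) (simp_all add: \<phi>_add, simp add: \<phi>_def)
    have "lookup (f * f ^ k) (m + iterate_add k m) = lookup f m * lookup (f ^ k) (iterate_add k m)"
    proof (rule lookup_mult_unique)
      fix a b assume "a \<in> keys f" "b \<in> keys (f ^ k)" "a + b = m + iterate_add k m"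
      then show "a = m \<and> b = iterate_add k m" using key[of a b] by (simp add: \<phi>_add \<phi>_it)
    qed
    moreover have "lookup f m \<noteq> 0" using m(1) by (simp add: in_keys_iff)
    ultimately have "lookup (f ^ Suc k) (iterate_add (Suc k) m) \<noteq> 0" using Suc by simp
    moreover have "\<phi> x \<le> Suc k * \<phi> m \<and> (\<phi> x = Suc k * \<phi> m \<longrightarrow> x = iterate_add (Suc k) m)"
      if x: "x \<in> keys (f ^ Suc k)" for x
    proof -
      obtain a b where "a \<in> keys f" "b \<in> keys (f ^ k)" "x = a + b"
        using x keys_mult[of f "f ^ k"] by auto
      then show ?thesis using key[of a b] by auto
    qed
    ultimately show ?case by blast
  qed
  then show ?thesis using that m(1) by (simp add: in_keys_iff)
qed

lemma newton_of_integral: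
  fixes f :: "('v::finite \<Rightarrow>\<^sub>0 nat) \<Rightarrow>\<^sub>0 'k::field"
  assumes u: "u = of_nat p / of_nat q" "q > 0" and E: "finite E"
    and f: "f \<in> polys V" "f ^ q \<in> int_closure (polys V) (mideal V E p)"
  shows "keys f \<subseteq> newton E u"
proof (rule ccontr)
  assume bad: "\<not> ?thesis"
  \<comment> \<open>\<open>g\<close> is the part of \<open>f\<close> inside the polyhedron. Removing
    it keeps the asymptotic property, and the vertex found below is then forced to lie
    outside.\<close>
  define g where "g = (\<Sum>m\<in>keys f \<inter> newton E u. single m (lookup f m))"
  have g: "lookup g m = (if m \<in> newton E u then lookup f m else 0)" for m
    by (auto simp: g_def lookup_sum lookup_single when_def in_keys_iff)
  have "keys g \<subseteq> newton E u" by (auto simp: in_keys_iff g split: if_splits)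
  then have "almost_in E p q (f + - g)"
    by (intro almost_in_add almost_in_uminus almost_in_integral[OF f u(2)] almost_in_newton[OF u] u(2))
  then obtain c where c: "\<And>i. (f - g) ^ i \<in> kspan (mpow E (p * ((i - c) div q)))"
    by (auto simp: almost_in_def)
  have keys: "keys (f - g) = keys f - newton E u"
    by (auto simp: in_keys_iff lookup_minus g split: if_splits)
  then have "f - g \<noteq> 0" using bad by auto
  then obtain m where m: "m \<in> keys (f - g)" "\<And>k. iterate_add k m \<in> keys ((f - g) ^ k)"
    using vertex_power by blast
  \<comment> \<open>At the power \<open>q * n + c\<close> the truncated quotient is exactly
    \<open>n\<close>.\<close>
  have "iterate_add (q * n + c) m \<in> mpow E (p * n)" for n
    using m(2)[of "q * n + c"] c[of "q * n + c"] u(2) by (auto simp: kspan_def simp del: iterate_add_distrib)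
  then have "m \<in> newton E u" using mpow_asymptotic[OF E, of q c m p] newton_fraction_iff[OF u, of m E] by simp
  then show False using m(1) keys by auto
qed

text \<open>The case \<open>u = 0\<close>, where \<open>newton\<close> is everything, is included
  because the sum runs over both endpoints of the interval.\<close>

lemma rat_power_mideal:
  fixes E :: "('v::finite \<Rightarrow>\<^sub>0 nat) set"
  assumes "finite E" "u \<ge> 0"
  shows "rat_power (polys V) (mideal V E 1) u =
    (kspan (exps V \<inter> newton E u) :: (('v \<Rightarrow>\<^sub>0 nat) \<Rightarrow>\<^sub>0 'k::field) set)"
proof -
  obtain p' q' where pq: "quotient_of u = (p', q')" by (cases "quotient_of u")
  have q': "q' > 0" using quotient_of_denom_pos[OF pq] .
  have u': "u = of_int p' / of_int q'" using quotient_of_div[OF pq] .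
  then have "p' \<ge> 0" using assms(2) q' by (simp add: zero_le_divide_iff)
  then obtain p q where p: "p' = int p" "q' = int q" using q' by (metis nonneg_int_cases order_less_imp_le)
  have u: "u = of_nat p / of_nat q" "q > 0" using u' q' p by auto
  have "rat_power (polys V) (mideal V E 1) u =
    {f \<in> polys V. f ^ q \<in> int_closure (polys V) (mideal V E p :: (('v \<Rightarrow>\<^sub>0 nat) \<Rightarrow>\<^sub>0 'k) set)}"
    by (simp add: rat_power_def pq p ideal_pow_mideal)
  also have "\<dots> = {f \<in> polys V. keys f \<subseteq> newton E u}"
    using newton_of_integral[OF u assms(1)] integral_of_newton[OF u] by blast
  also have "\<dots> = kspan (exps V \<inter> newton E u)" by (auto simp: kspan_def)
  finally show ?thesis .
qed

section \<open>Finitely many rational powers of bounded exponent\<close>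

lemma lookup_sum_mset_le:
  fixes A :: "('v \<Rightarrow>\<^sub>0 nat) multiset"
  assumes "\<And>e. e \<in># A \<Longrightarrow> lookup e v \<le> D"
  shows "lookup (sum_mset A) v \<le> size A * D"
  using assms
proof (induction A)
  case (add e A)
  then show ?case using add_mono[of "lookup e v" D "lookup (sum_mset A) v" "size A * D"]
    by (simp add: lookup_add)
qed simp

lemma finite_bounded_exponents: "finite {m :: 'v::finite \<Rightarrow>\<^sub>0 nat. \<forall>v. lookup m v \<le> B}"
proof (rule finite_imageD)
  have "lookup ` {m :: 'v \<Rightarrow>\<^sub>0 nat. \<forall>v. lookup m v \<le> B} \<subseteq> PiE UNIV (\<lambda>_. {..B})" by auto
  then show "finite (lookup ` {m :: 'v \<Rightarrow>\<^sub>0 nat. \<forall>v. lookup m v \<le> B})"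
    by (rule finite_subset) (simp add: finite_PiE)
qed (rule inj_onI, rule poly_mapping_eqI, erule fun_cong)

text \<open>Exponents can be truncated at a height depending only on the bound for the rational power.\<close>
lemma finite_newton:
  fixes E :: "('v::finite \<Rightarrow>\<^sub>0 nat) set"
  assumes "finite E"
  shows "finite (newton E ` {0..u})"
proof -
  define D where "D = (\<Sum>e\<in>E. \<Sum>v\<in>UNIV. lookup e v)"
  have D: "lookup e v \<le> D" if "e \<in> E" for e v
  proof -
    have "lookup e v \<le> (\<Sum>v\<in>UNIV. lookup e v)" by (rule member_le_sum) auto
    also have "\<dots> \<le> D" unfolding D_def using assms that by (intro member_le_sum) auto
    finally show ?thesis .
  qed
  \<comment> \<open>Generators have coordinates at most \<open>D\<close>, so a sum of
    \<open>K = \<omega> * N\<close> of them has coordinates at most \<open>N * B\<close>; above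
    height \<open>B\<close> the coordinates of \<open>m\<close> do not affect membership.\<close>
  obtain B where B: "u * of_nat D \<le> of_nat B" using real_arch_simple by blast
  define trunc :: "('v \<Rightarrow>\<^sub>0 nat) \<Rightarrow> 'v \<Rightarrow>\<^sub>0 nat" where "trunc = Poly_Mapping.map (min B)"
  have lookup_trunc: "lookup (trunc m) v = min B (lookup m v)" for m :: "'v \<Rightarrow>\<^sub>0 nat" and v
    by (simp add: trunc_def map.rep_eq when_def)
  define Box where "Box = {m :: 'v \<Rightarrow>\<^sub>0 nat. \<forall>v. lookup m v \<le> B}"
  have trunc_iff: "m \<in> newton E \<omega> \<longleftrightarrow> trunc m \<in> newton E \<omega>" if \<omega>: "\<omega> \<in> {0..u}" for m \<omega>
  proof
    assume "trunc m \<in> newton E \<omega>"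
    moreover have "m = trunc m + (m - trunc m)" by (rule exponent_diff) (simp add: lookup_trunc)
    ultimately show "m \<in> newton E \<omega>" using newton_up by metis
  next
    assume "m \<in> newton E \<omega>"
    then obtain N K A d where N: "N \<ge> 1" "of_nat K = \<omega> * of_nat N"
      "iterate_add N m = sum_mset A + d" "set_mset A \<subseteq> E" "size A = K"
      unfolding newton_def mpow_def by blast
    have "lookup (sum_mset A) v \<le> lookup (iterate_add N (trunc m)) v" for v
    proof -
      have "lookup (sum_mset A) v \<le> K * D" using lookup_sum_mset_le[of A v D] N(4,5) D by auto
      moreover have "K * D \<le> N * B"
      proof -
        have "of_nat (K * D) = of_nat N * (\<omega> * of_nat D)" using N(2) by simp
        also have "\<dots> \<le> of_nat N * (u * of_nat D)"
          using \<omega> by (intro mult_left_mono mult_right_mono) auto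
        also have "\<dots> \<le> of_nat N * of_nat B" using B by (intro mult_left_mono) auto
        finally show ?thesis by (metis of_nat_le_iff of_nat_mult)
      qed
      moreover have "lookup (sum_mset A) v \<le> N * lookup m v"
        using arg_cong[OF N(3), of "\<lambda>m. lookup m v"] by (simp add: lookup_iterate_add lookup_add)
      ultimately show ?thesis by (simp add: lookup_iterate_add lookup_trunc min_def)
    qed
    then have "iterate_add N (trunc m) \<in> mpow E K"
      using mpowI[OF N(4,5), of "iterate_add N (trunc m) - sum_mset A"] exponent_diff by metis
    then show "trunc m \<in> newton E \<omega>" using N(1,2) unfolding newton_def by blast
  qed
  \<comment> \<open>Truncation lands in \<open>Box\<close>, so \<open>newton E \<omega>\<close> is
    determined by its trace on this finite set.\<close>
  have "newton E \<omega> = {m. trunc m \<in> newton E \<omega> \<inter> Box}" if "\<omega> \<in> {0..u}" for \<omega>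
    using trunc_iff[OF that] by (auto simp: Box_def lookup_trunc)
  then have sub: "newton E ` {0..u} \<subseteq> (\<lambda>S. {m. trunc m \<in> S}) ` Pow Box"
    by (intro image_subsetI image_eqI[of _ _ "newton E _ \<inter> Box"]) auto
  show ?thesis
    by (rule finite_subset[OF sub]) (simp add: Box_def finite_bounded_exponents)
qed

section \<open>Sums of monomial ideals in disjoint variables\<close>

text \<open>Sums of elements of \<open>E\<close> vanish outside \<open>V\<close>, so domination of
  such a sum is tested on \<open>V\<close> alone.\<close>

lemma mpow_restrict:
  fixes E :: "('v \<Rightarrow>\<^sub>0 nat) set"
  assumes "E \<subseteq> exps V" "a \<in> mpow E k" "\<And>v. v \<in> V \<Longrightarrow> lookup a v \<le> lookup x v"
  shows "x \<in> mpow E k"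
proof -
  obtain A d where A: "a = sum_mset A + d" "set_mset A \<subseteq> E" "size A = k"
    using assms(2) by (auto simp: mpow_def)
  have "lookup (sum_mset A) v \<le> lookup x v" for v
  proof (cases "v \<in> V")
    case True
    then show ?thesis using assms(3)[of v] A(1) by (simp add: lookup_add)
  next
    case False
    then have "lookup e v \<le> 0" if "e \<in># A" for e
      using A(2) assms(1) that by (force simp: exps_def in_keys_iff)
    then show ?thesis using lookup_sum_mset_le[of A v 0] by simp
  qed
  then have "x = sum_mset A + (x - sum_mset A)" by (rule exponent_diff)
  then show ?thesis using mpowI[OF A(2,3)] by metis
qed

lemma restrict_exponent:
  fixes m :: "'v \<Rightarrow>\<^sub>0 nat"
  obtains m' where "m' \<in> exps V" "\<And>v. lookup m' v = (if v \<in> V then lookup m v else 0)"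
proof -
  define m' where "m' = Abs_poly_mapping (\<lambda>v. if v \<in> V then lookup m v else 0)"
  have "finite {v. (if v \<in> V then lookup m v else 0) \<noteq> 0}"
    by (rule finite_subset[OF _ finite_lookup[of m]]) auto
  then have "lookup m' v = (if v \<in> V then lookup m v else 0)" for v
    unfolding m'_def by simp
  moreover from this have "m' \<in> exps V" by (auto simp: exps_def in_keys_iff split: if_splits)
  ultimately show ?thesis using that by blast
qed

lemma newton_Un_split:
  fixes E F :: "('v \<Rightarrow>\<^sub>0 nat) set"
  assumes "E \<subseteq> exps V" "F \<subseteq> exps (- V)" "m \<in> newton (E \<union> F) u"
  obtains \<omega> a b where "0 \<le> \<omega>" "\<omega> \<le> u" "m = a + b" "a \<in> exps V \<inter> newton E \<omega>"
    "b \<in> exps (- V) \<inter> newton F (u - \<omega>)"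
proof -
  obtain N K where N: "N \<ge> 1" "of_nat K = u * of_nat N" "iterate_add N m \<in> mpow (E \<union> F) K"
    using assms(3) by (auto simp: newton_def)
  obtain i j x y where xy: "i + j = K" "x \<in> mpow E i" "y \<in> mpow F j" "iterate_add N m = x + y"
    using mpow_Un_split[OF N(3)] by metis
  obtain a where a: "a \<in> exps V" "\<And>v. lookup a v = (if v \<in> V then lookup m v else 0)"
    using restrict_exponent by metis
  obtain b where b: "b \<in> exps (- V)" "\<And>v. lookup b v = (if v \<in> - V then lookup m v else 0)"
    using restrict_exponent by metis
  have le: "lookup x v \<le> N * lookup m v" "lookup y v \<le> N * lookup m v" for v
    using arg_cong[OF xy(4), of "\<lambda>m. lookup m v"] by (auto simp: lookup_iterate_add lookup_add)
  have "iterate_add N a \<in> mpow E i"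
    using assms(1) xy(2) by (rule mpow_restrict) (use le a(2) in \<open>auto simp: lookup_iterate_add\<close>)
  moreover have "iterate_add N b \<in> mpow F j"
    using assms(2) xy(3) by (rule mpow_restrict) (use le b(2) in \<open>auto simp: lookup_iterate_add\<close>)
  \<comment> \<open>\<open>\<omega>\<close> is the share of \<open>E\<close>: \<open>i\<close> of
    the \<open>K = i + j\<close> generators for \<open>N\<close> copies of \<open>m\<close>, which
    leaves \<open>j / N = u - \<omega>\<close> for \<open>F\<close>.\<close>
  moreover define \<omega> :: rat where "\<omega> = of_nat i / of_nat N"
  moreover have i: "of_nat i = \<omega> * of_nat N" using N(1) by (simp add: \<omega>_def)
  moreover have j: "of_nat j = (u - \<omega>) * of_nat N"
    using i N(2) xy(1) by (simp add: left_diff_distrib flip: N(2))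
  ultimately have "a \<in> newton E \<omega>" "b \<in> newton F (u - \<omega>)" using N(1) unfolding newton_def by blast+
  moreover have "m = a + b" by (rule poly_mapping_eqI) (simp add: lookup_add a(2) b(2))
  moreover have "0 \<le> \<omega>" by (simp add: \<omega>_def)
  moreover have "\<omega> \<le> u"
  proof -
    have "0 \<le> (u - \<omega>) * of_nat N" using j by (metis of_nat_0_le_iff)
    then show ?thesis using N(1) by (simp add: zero_le_mult_iff)
  qed
  ultimately show ?thesis using that a(1) b(1) by blast
qed

section \<open>Extension to the full polynomial ring and the sum formula\<close>

lemma ideal_add_ext_mideal:
  fixes E F :: "('v \<Rightarrow>\<^sub>0 nat) set"
  assumes "E \<subseteq> exps V" "F \<subseteq> exps W"
  shows "ideal_add UNIV (ext_ideal (mideal V E 1)) (ext_ideal (mideal W F 1)) =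
    (mideal UNIV (E \<union> F) 1 :: (('v \<Rightarrow>\<^sub>0 nat) \<Rightarrow>\<^sub>0 'k::comm_ring_1) set)" (is "ideal_add UNIV ?I ?J = ?M")
proof
  have M: "ideal_in UNIV ?M" using ideal_in_mideal[of UNIV] by simp
  have "mideal V E 1 \<subseteq> ?M" "mideal W F 1 \<subseteq> ?M"
    unfolding mideal_def using mpow_mono[of E "E \<union> F"] mpow_mono[of F "E \<union> F"]
    by (auto intro!: kspan_mono)
  then have sub: "?I \<union> ?J \<subseteq> ?M" unfolding ext_ideal_def using gen_ideal_least[OF M] by simp
  then show "ideal_add UNIV ?I ?J \<subseteq> ?M" unfolding ideal_add_def by (rule gen_ideal_least[OF M])
  have "(\<lambda>e. single e (1::'k)) ` E \<subseteq> mideal V E 1"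
    using assms(1) by (force simp: mideal_def mpow_1 intro: exI[of _ 0])
  moreover have "(\<lambda>e. single e (1::'k)) ` F \<subseteq> mideal W F 1"
    using assms(2) by (force simp: mideal_def mpow_1 intro: exI[of _ 0])
  moreover have "mideal V E 1 \<subseteq> ?I" "mideal W F 1 \<subseteq> ?J"
    unfolding ext_ideal_def by (rule gen_ideal_superset)+
  moreover have "?I \<union> ?J \<subseteq> ideal_add UNIV ?I ?J"
    unfolding ideal_add_def by (rule gen_ideal_superset)
  ultimately have "(\<lambda>e. single e 1) ` (E \<union> F) \<subseteq> ideal_add UNIV ?I ?J"
    unfolding image_Un by (meson Un_subset_iff order_trans)
  then have "gen_ideal UNIV ((\<lambda>e. single e 1) ` (E \<union> F)) \<subseteq> ideal_add UNIV ?I ?J"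
    unfolding ideal_add_def using ideal_in_gen_ideal[OF M sub] by (intro gen_ideal_least) auto
  then show "?M \<subseteq> ideal_add UNIV ?I ?J"
    using gen_ideal_monomials[of "E \<union> F" UNIV, where ?'k = 'k] by simp
qed

lemma ringA_eq: "ringA = polys (Collect isl)"
  by (simp add: ringA_def kspan_def exps_def subset_eq)

lemma ringB_eq: "ringB = polys (- Collect isl)"
  by (simp add: ringB_def kspan_def exps_def subset_eq)

theorem theorem2p2:
  fixes I J :: "('a::finite, 'b::finite, 'k::field) spoly set"
    and u :: rat
  assumes "monomial_ideal ringA I"
    and "monomial_ideal ringB J"
    and "u > 0"
  shows "rat_power UNIV (ideal_add UNIV (ext_ideal I) (ext_ideal J)) u =
           gen_ideal UNIV (\<Union>\<omega>\<in>{\<omega>::rat. 0 \<le> \<omega> \<and> \<omega> \<le> u}.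
              ideal_mult UNIV (ext_ideal (rat_power ringA I \<omega>))
                              (ext_ideal (rat_power ringB J (u - \<omega>))))
         \<and> finite ((\<lambda>\<omega>. ideal_mult UNIV (ext_ideal (rat_power ringA I \<omega>))
                              (ext_ideal (rat_power ringB J (u - \<omega>))))
                   ` {\<omega>::rat. 0 \<le> \<omega> \<and> \<omega> \<le> u})"
proof -
  define V :: "('a + 'b) set" where "V = Collect isl"
  obtain E where E: "finite E" "E \<subseteq> exps V" "I = mideal V E 1"
    using monomial_ideal_finite_exponents assms(1) unfolding ringA_eq V_def by blast
  obtain F where F: "finite F" "F \<subseteq> exps (- V)" "J = mideal (- V) F 1"
    using monomial_ideal_finite_exponents assms(2) unfolding ringB_eq V_def by blast
  \<comment> \<open>Each summand depends on \<open>\<omega>\<close> only through two polyhedra,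
    which is what bounds the number of distinct summands.\<close>
  define P where "P S T = ideal_mult UNIV (ext_ideal (kspan (exps V \<inter> S)))
    (ext_ideal (kspan (exps (- V) \<inter> T)) :: ('a, 'b, 'k) spoly set)" for S T
  have P: "ideal_mult UNIV (ext_ideal (rat_power ringA I \<omega>)) (ext_ideal (rat_power ringB J (u - \<omega>))) =
    P (newton E \<omega>) (newton F (u - \<omega>))" if "\<omega> \<in> {0..u}" for \<omega>
    using that rat_power_mideal[OF E(1), where V = V and ?'k = 'k]
      rat_power_mideal[OF F(1), where V = "- V" and ?'k = 'k]
    unfolding P_def ringA_eq ringB_eq E(3) F(3) V_def[symmetric] by simp
  have interval: "{\<omega>::rat. 0 \<le> \<omega> \<and> \<omega> \<le> u} = {0..u}" by auto
  \<comment> \<open>Both sides are shown to equal \<open>L\<close>. The summands lie in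
    \<open>L\<close> because polyhedra add; conversely, splitting a monomial along the two sets of
    variables puts it into one summand.\<close>
  define L :: "('a, 'b, 'k) spoly set" where "L = kspan (newton (E \<union> F) u)"
  have L: "ideal_in UNIV L"
    using ideal_in_kspan[of "newton (E \<union> F) u" UNIV] newton_up by (auto simp: L_def)
  have lhs: "rat_power UNIV (ideal_add UNIV (ext_ideal I) (ext_ideal J)) u = L"
    using rat_power_mideal[of "E \<union> F" u UNIV, where ?'k = 'k] E F assms(3)
      ideal_add_ext_mideal[OF E(2) F(2), where ?'k = 'k]
    by (simp add: L_def)
  have sub: "(\<Union>\<omega>\<in>{0..u}. P (newton E \<omega>) (newton F (u - \<omega>))) \<subseteq> L"
  proof (rule UN_least)
    fix \<omega> assume "\<omega> \<in> {0..u}"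
    have ext: "ext_ideal (kspan (X \<inter> newton G w)) \<subseteq> (kspan (newton G w) :: ('a, 'b, 'k) spoly set)"
      for X G w
      unfolding ext_ideal_def using ideal_in_kspan[of "newton G w" UNIV] newton_up
      by (intro gen_ideal_least kspan_mono) auto
    have "f * g \<in> L" if "f \<in> kspan (newton E \<omega>)" "g \<in> kspan (newton F (u - \<omega>))" for f g
      using that unfolding L_def by (rule kspan_mult) (use newton_add[of _ E \<omega> _ F "u - \<omega>"] in simp)
    then show "P (newton E \<omega>) (newton F (u - \<omega>)) \<subseteq> L"
      unfolding P_def ideal_mult_def using ext by (intro gen_ideal_least[OF L]) blast
  qed
  have "L \<subseteq> gen_ideal UNIV (\<Union>\<omega>\<in>{0..u}. P (newton E \<omega>) (newton F (u - \<omega>)))" (is "_ \<subseteq> ?G")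
    unfolding L_def
  proof (rule kspan_subset_ideal[of UNIV])
    show "ideal_in (polys UNIV) ?G" using ideal_in_gen_ideal[OF L sub] by simp
    fix m assume "m \<in> newton (E \<union> F) u"
    then obtain \<omega> a b where *: "\<omega> \<in> {0..u}" "m = a + b" "a \<in> exps V \<inter> newton E \<omega>"
      "b \<in> exps (- V) \<inter> newton F (u - \<omega>)"
      using newton_Un_split[OF E(2) F(2)] by (metis atLeastAtMost_iff)
    have "single a (1::'k) \<in> ext_ideal (kspan (exps V \<inter> newton E \<omega>))"
      unfolding ext_ideal_def using * by (intro subsetD[OF gen_ideal_superset]) simp
    moreover have "single b (1::'k) \<in> ext_ideal (kspan (exps (- V) \<inter> newton F (u - \<omega>)))"
      unfolding ext_ideal_def using * by (intro subsetD[OF gen_ideal_superset]) simp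
    ultimately have "single a 1 * single b 1 \<in> P (newton E \<omega>) (newton F (u - \<omega>))"
      unfolding P_def ideal_mult_def by (intro subsetD[OF gen_ideal_superset]) blast
    then have "single m 1 \<in> P (newton E \<omega>) (newton F (u - \<omega>))" using * by (simp add: mult_single)
    then show "single m 1 \<in> ?G" using *(1) by (intro subsetD[OF gen_ideal_superset]) blast
  qed
  with gen_ideal_least[OF L sub] have eq: "L = ?G" by blast
  \<comment> \<open>With \<open>\<omega>\<close> also \<open>u - \<omega>\<close> stays in
    \<open>{0..u}\<close>, so both polyhedra take finitely many values.\<close>
  have "(\<lambda>\<omega>. P (newton E \<omega>) (newton F (u - \<omega>))) ` {0..u} \<subseteq>
    (\<lambda>(S, T). P S T) ` (newton E ` {0..u} \<times> newton F ` {0..u})"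
    by auto
  then have "finite ((\<lambda>\<omega>. P (newton E \<omega>) (newton F (u - \<omega>))) ` {0..u})"
    by (rule finite_subset) (intro finite_imageI finite_cartesian_product finite_newton E F)
  then show ?thesis unfolding lhs interval using eq P by simp
qed

end
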